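(* For every $\epsilon\in(0,\epsilon^*]$, the implicit Euler scheme $u_n^\epsilon=u_{n-1}^\epsilon+\epsilon Fu_n^\epsilon$ has a unique numerical attractor $\mathcal A^\epsilon$, and it can be expressed as $$\mathcal A^\epsilon=\bigcap_{m\in\mathbb N}\overline{\bigcup_{n\ge m}S_\epsilon(n)B_{r^*}}.$$
   Context: $\ell^2$ is the Hilbert space of real square-summable sequences $u=(u_i)_{i\in\mathbb Z}$ with norm $\|u\|=(\sum_i u_i^2)^{1/2}$; $B_r=\{u\in\ell^2:\|u\|\le r\}$. Parameters: $\alpha,\beta,\nu,\lambda>0$, $\gamma\in(0,1)$, $f\in\ell^2$. Operators: $(\Lambda u)_i=-u_{i-1}+2u_i-u_{i+1}$, $(D^-u)_i=u_{i-1}-u_i$. Products of sequences are componentwise. The vector field is $Fu=\nu\Lambda u-\alpha uD^-u+\beta u(1-u)(u-\gamma)-\lambda u+f$. Constants: $\lambda^*=4\nu+\frac{(2\alpha+\beta+\beta\gamma)^2}{4\beta}-\beta\gamma$, with standing assumption $\lambda>\lambda^*$; for $r>0$, $M_r=\beta r^3+(2\alpha+\beta+\beta\gamma)r^2+(4\nu+\beta\gamma+\lambda)r+\|f\|$, $L_r=4\nu+2\sqrt5\,r\alpha+\sqrt{12r^2(1+\gamma)^2+27r^4+3\gamma^2}\,\beta+\lambda$; $r^*=1+\frac{\|f\|}{\lambda-\lambda^*}$; $\epsilon^*=\min\left(\frac1{M_{r^*+1}},\frac1{1+L_{r^*+1}}\right)$. For $\epsilon\in(0,\epsilon^*]$ and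 $y\in B_{r^*}$ the scheme with $u_0^\epsilon=y$ has a unique solution $u_n^\epsilon(y)\in B_{r^*}$, $n\in\mathbb N$; this defines the discrete dynamical system $S_\epsilon(n):B_{r^*}\to B_{r^*}$, $S_\epsilon(n)y=u_n^\epsilon(y)$. The Hausdorff semi-distance is $d_{\ell^2}(A,B)=\sup_{a\in A}\inf_{b\in B}\|a-b\|$. A numerical attractor of the scheme is a compact set $\mathcal A^\epsilon\subset\ell^2$ (contained in $B_{r^*}$, the domain of $S_\epsilon(n)$) such that $S_\epsilon(n)\mathcal A^\epsilon=\mathcal A^\epsilon$ for all $n\in\mathbb N$ and $\lim_{n\to\infty}d_{\ell^2}(S_\epsilon(n)B_{r^*},\mathcal A^\epsilon)=0$. *)

theory Defs
  imports "HOL-Analysis.Analysis"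
begin

section \<open>The Hilbert space of square-summable bi-infinite real sequences\<close>

typedef ell2 = "{u :: int \<Rightarrow> real. (\<lambda>i. (u i)\<^sup>2) summable_on UNIV}"
  morphisms coord Abs_ell2
  by (rule exI[of _ "\<lambda>_. 0"]) simp

setup_lifting type_definition_ell2

lemma square_summable_coord: "(\<lambda>i. (coord u i)\<^sup>2) summable_on UNIV"
  using coord[of u] by simp

lemma square_summable_add:
  fixes u v :: "int \<Rightarrow> real"
  assumes "(\<lambda>i. (u i)\<^sup>2) summable_on UNIV" "(\<lambda>i. (v i)\<^sup>2) summable_on UNIV"
  shows "(\<lambda>i. (u i + v i)\<^sup>2) summable_on UNIV"
proof (rule summable_on_comparison_test)
  show "(\<lambda>i. 2 * (u i)\<^sup>2 + 2 * (v i)\<^sup>2) summable_on UNIV"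
    by (intro summable_on_add summable_on_cmult_right assms)
  show "(u i + v i)\<^sup>2 \<le> 2 * (u i)\<^sup>2 + 2 * (v i)\<^sup>2" for i
    using sum_squares_bound[of "u i" "v i"] by (simp add: power2_sum)
qed simp

lemma square_summable_scale:
  fixes u :: "int \<Rightarrow> real"
  assumes "(\<lambda>i. (u i)\<^sup>2) summable_on UNIV"
  shows "(\<lambda>i. (c * u i)\<^sup>2) summable_on UNIV"
  using summable_on_cmult_right[OF assms, of "c\<^sup>2"] by (simp add: power_mult_distrib)

lemma square_summable_diff:
  fixes u v :: "int \<Rightarrow> real"
  assumes "(\<lambda>i. (u i)\<^sup>2) summable_on UNIV" "(\<lambda>i. (v i)\<^sup>2) summable_on UNIV"
  shows "(\<lambda>i. (u i - v i)\<^sup>2) summable_on UNIV"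
  using square_summable_add[OF assms(1) square_summable_scale[OF assms(2), of "-1"]] by simp

lemma square_summable_shift:
  fixes u :: "int \<Rightarrow> real"
  assumes "(\<lambda>i. (u i)\<^sup>2) summable_on UNIV"
  shows "(\<lambda>i. (u (i + k))\<^sup>2) summable_on UNIV"
proof -
  have "bij_betw (\<lambda>i. i + k) UNIV (UNIV :: int set)"
    by (rule bij_betw_byWitness[of _ "\<lambda>i. i - k"]) auto
  from summable_on_reindex_bij_betw[OF this, of "\<lambda>i. (u i)\<^sup>2"] assms show ?thesis by simp
qed

lemma square_summable_bounded_mult:
  fixes u v :: "int \<Rightarrow> real"
  assumes "(\<lambda>i. (u i)\<^sup>2) summable_on UNIV" "\<And>i. \<bar>v i\<bar> \<le> C"
  shows "(\<lambda>i. (u i * v i)\<^sup>2) summable_on UNIV"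
proof (rule summable_on_comparison_test)
  show "(\<lambda>i. C\<^sup>2 * (u i)\<^sup>2) summable_on UNIV"
    by (intro summable_on_cmult_right assms)
  show "(u i * v i)\<^sup>2 \<le> C\<^sup>2 * (u i)\<^sup>2" for i
  proof -
    have "\<bar>v i\<bar> ^ 2 \<le> C ^ 2" by (rule power_mono) (use assms(2)[of i] in auto)
    hence "(v i)\<^sup>2 \<le> C\<^sup>2" by simp
    from mult_right_mono[OF this, of "(u i)\<^sup>2"] show ?thesis
      by (simp add: power_mult_distrib mult.commute)
  qed
qed simp

lemma square_summable_imp_bounded:
  fixes u :: "int \<Rightarrow> real"
  assumes "(\<lambda>i. (u i)\<^sup>2) summable_on UNIV"
  shows "\<exists>C. \<forall>i. \<bar>u i\<bar> \<le> C"
proof (intro exI allI)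
  show "\<bar>u i\<bar> \<le> sqrt (\<Sum>\<^sub>\<infinity>i. (u i)\<^sup>2)" for i
    using finite_sum_le_infsum[OF assms, of "{i}"] by (simp add: real_le_rsqrt)
qed

lemma square_summable_mult:
  fixes u v :: "int \<Rightarrow> real"
  assumes "(\<lambda>i. (u i)\<^sup>2) summable_on UNIV" "(\<lambda>i. (v i)\<^sup>2) summable_on UNIV"
  shows "(\<lambda>i. (u i * v i)\<^sup>2) summable_on UNIV"
  using square_summable_imp_bounded[OF assms(2)] square_summable_bounded_mult[OF assms(1)]
  by blast

lemma product_summable:
  fixes u v :: "int \<Rightarrow> real"
  assumes "(\<lambda>i. (u i)\<^sup>2) summable_on UNIV" "(\<lambda>i. (v i)\<^sup>2) summable_on UNIV"
  shows "(\<lambda>i. u i * v i) summable_on UNIV"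
proof -
  have "(\<lambda>i. (1/2) * ((u i + v i)\<^sup>2 + ((-1) * (u i)\<^sup>2 + (-1) * (v i)\<^sup>2))) summable_on UNIV"
    by (intro summable_on_cmult_right summable_on_add square_summable_add assms)
  thus ?thesis by (simp add: power2_sum)
qed

instantiation ell2 :: real_vector
begin
lift_definition zero_ell2 :: ell2 is "\<lambda>_. 0" by simp
lift_definition plus_ell2 :: "ell2 \<Rightarrow> ell2 \<Rightarrow> ell2" is "\<lambda>u v i. u i + v i"
  by (rule square_summable_add)
lift_definition minus_ell2 :: "ell2 \<Rightarrow> ell2 \<Rightarrow> ell2" is "\<lambda>u v i. u i - v i"
  by (rule square_summable_diff)
lift_definition uminus_ell2 :: "ell2 \<Rightarrow> ell2" is "\<lambda>u i. - u i" by simp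
lift_definition scaleR_ell2 :: "real \<Rightarrow> ell2 \<Rightarrow> ell2" is "\<lambda>c u i. c * u i"
  by (rule square_summable_scale)
instance
  by standard (transfer; simp add: fun_eq_iff algebra_simps)+
end

instantiation ell2 :: real_inner
begin
definition inner_ell2 :: "ell2 \<Rightarrow> ell2 \<Rightarrow> real"
  where "inner_ell2 u v = (\<Sum>\<^sub>\<infinity>i. coord u i * coord v i)"
definition norm_ell2 :: "ell2 \<Rightarrow> real"
  where "norm_ell2 u = sqrt (\<Sum>\<^sub>\<infinity>i. (coord u i)\<^sup>2)"
definition sgn_ell2 :: "ell2 \<Rightarrow> ell2"
  where "sgn_ell2 u = u /\<^sub>R norm u"
definition dist_ell2 :: "ell2 \<Rightarrow> ell2 \<Rightarrow> real"
  where "dist_ell2 u v = norm (u - v)"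
definition uniformity_ell2 :: "(ell2 \<times> ell2) filter"
  where "uniformity_ell2 = (INF e\<in>{0<..}. principal {(u, v). dist u v < e})"
definition open_ell2 :: "ell2 set \<Rightarrow> bool"
  where "open_ell2 U \<longleftrightarrow> (\<forall>u\<in>U. eventually (\<lambda>(u', v). u' = u \<longrightarrow> v \<in> U) uniformity)"
instance
proof
  fix u v w :: ell2 and c :: real and U :: "ell2 set"
  note product_summable_coord =
    product_summable[OF square_summable_coord square_summable_coord]
  show "sgn u = u /\<^sub>R norm u" by (rule sgn_ell2_def)
  show "dist u v = norm (u - v)" by (rule dist_ell2_def)
  show "uniformity = (INF e\<in>{0<..}. principal {(u::ell2, v). dist u v < e})"
    by (rule uniformity_ell2_def)
  show "open U \<longleftrightarrow> (\<forall>u\<in>U. \<forall>\<^sub>F (u', v) in uniformity. u' = u \<longrightarrow> v \<in> U)"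
    by (rule open_ell2_def)
  show "inner u v = inner v u" by (simp add: inner_ell2_def mult.commute)
  show "inner (u + v) w = inner u w + inner v w"
    by (simp add: inner_ell2_def plus_ell2.rep_eq distrib_right
        infsum_add product_summable_coord)
  show "inner (c *\<^sub>R u) v = c * inner u v"
    by (simp add: inner_ell2_def scaleR_ell2.rep_eq mult.assoc
        infsum_cmult_right product_summable_coord)
  show "0 \<le> inner u u" unfolding inner_ell2_def by (rule infsum_nonneg) simp
  show "inner u u = 0 \<longleftrightarrow> u = 0"
  proof
    assume "inner u u = 0"
    hence "coord u i * coord u i = 0" for i
      unfolding inner_ell2_def
      by (intro nonneg_infsum_le_0D[of "\<lambda>i. coord u i * coord u i" UNIV])
        (auto simp: product_summable_coord)
    thus "u = 0" by (simp add: coord_inject[symmetric] zero_ell2.rep_eq fun_eq_iff)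
  qed (simp add: inner_ell2_def zero_ell2.rep_eq)
  show "norm u = sqrt (inner u u)" by (simp add: norm_ell2_def inner_ell2_def power2_eq_square)
qed
end

lemma abs_coord_le_norm: "\<bar>coord u i\<bar> \<le> norm u"
  unfolding norm_ell2_def
  using finite_sum_le_infsum[OF square_summable_coord, of "{i}" u] by (simp add: real_le_rsqrt)

instance ell2 :: complete_space
proof
  fix X :: "nat \<Rightarrow> ell2"
  assume X: "Cauchy X"
  have "Cauchy (\<lambda>n. coord (X n) i)" for i
  proof (rule metric_CauchyI)
    fix e :: real assume "e > 0"
    then obtain N where "\<forall>m\<ge>N. \<forall>n\<ge>N. dist (X m) (X n) < e"
      using metric_CauchyD[OF X] by blast
    moreover have "dist (coord (X m) i) (coord (X n) i) \<le> dist (X m) (X n)" for m n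
      using abs_coord_le_norm[of "X m - X n" i]
      by (simp add: dist_norm minus_ell2.rep_eq)
    ultimately show "\<exists>N. \<forall>m\<ge>N. \<forall>n\<ge>N. dist (coord (X m) i) (coord (X n) i) < e"
      by (meson le_less_trans)
  qed
  hence x: "(\<lambda>n. coord (X n) i) \<longlonglongrightarrow> lim (\<lambda>n. coord (X n) i)" for i
    by (simp add: Cauchy_convergent_iff convergent_LIMSEQ_iff)
  define x where "x = (\<lambda>i. lim (\<lambda>n. coord (X n) i))"
  have x: "(\<lambda>n. coord (X n) i) \<longlonglongrightarrow> x i" for i
    using x by (simp add: x_def)
  have partial: "sum (\<lambda>i. (x i - coord (X n) i)\<^sup>2) I \<le> e\<^sup>2"
    if "finite I" "\<forall>m\<ge>N. norm (X m - X n) \<le> e" for I e n N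
  proof (rule LIMSEQ_le_const2)
    show "(\<lambda>m. \<Sum>i\<in>I. (coord (X m) i - coord (X n) i)\<^sup>2)
            \<longlonglongrightarrow> (\<Sum>i\<in>I. (x i - coord (X n) i)\<^sup>2)"
      by (intro tendsto_intros x)
    have "(\<Sum>i\<in>I. (coord (X m) i - coord (X n) i)\<^sup>2) \<le> e\<^sup>2" if "m \<ge> N" for m
    proof -
      have "(\<Sum>i\<in>I. (coord (X m - X n) i)\<^sup>2) \<le> (\<Sum>\<^sub>\<infinity>i. (coord (X m - X n) i)\<^sup>2)"
        by (rule finite_sum_le_infsum) (use \<open>finite I\<close> square_summable_coord in auto)
      also have "\<dots> = (norm (X m - X n))\<^sup>2"
        by (simp add: norm_ell2_def infsum_nonneg)
      also have "\<dots> \<le> e\<^sup>2"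
        using \<open>\<forall>m\<ge>N. norm (X m - X n) \<le> e\<close> \<open>m \<ge> N\<close> by (intro power_mono) auto
      finally show ?thesis by (simp add: minus_ell2.rep_eq)
    qed
    thus "\<exists>N. \<forall>m\<ge>N. (\<Sum>i\<in>I. (coord (X m) i - coord (X n) i)\<^sup>2) \<le> e\<^sup>2" by blast
  qed
  have summable_diff: "(\<lambda>i. (x i - coord (X n) i)\<^sup>2) summable_on UNIV"
    if "\<forall>m\<ge>N. norm (X m - X n) \<le> e" for n N e
    by (rule nonneg_bdd_above_summable_on)
      (use partial[OF _ that] in \<open>auto intro!: bdd_aboveI2[where M = "e\<^sup>2"]\<close>)
  have ev: "\<exists>N. \<forall>n\<ge>N. \<forall>m\<ge>N. norm (X m - X n) \<le> e" if "e > 0" for e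
    using CauchyD[OF X that] by (meson less_imp_le)
  obtain N where "\<forall>n\<ge>N. \<forall>m\<ge>N. norm (X m - X n) \<le> 1" using ev[of 1] by auto
  hence "(\<lambda>i. (x i - coord (X N) i)\<^sup>2) summable_on UNIV" by (intro summable_diff[of N]) auto
  from square_summable_add[OF this square_summable_coord[of "X N"]]
  have "(\<lambda>i. (x i)\<^sup>2) summable_on UNIV" by simp
  hence L: "coord (Abs_ell2 x) = x" by (simp add: Abs_ell2_inverse)
  define L where "L = Abs_ell2 x"
  have L: "coord L = x" using L by (simp add: L_def)
  have "X \<longlonglongrightarrow> L"
  proof (rule LIMSEQ_I)
    fix r :: real assume "r > 0"
    then obtain N where N: "\<forall>n\<ge>N. \<forall>m\<ge>N. norm (X m - X n) \<le> r / 2"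
      using ev[of "r / 2"] by auto
    have "norm (X n - L) < r" if "n \<ge> N" for n
    proof -
      have *: "\<forall>m\<ge>N. norm (X m - X n) \<le> r / 2" using N that by auto
      have "(\<Sum>\<^sub>\<infinity>i. (x i - coord (X n) i)\<^sup>2) \<le> (r / 2)\<^sup>2"
        by (rule infsum_le_finite_sums) (use summable_diff[OF *] partial[OF _ *] in auto)
      hence "norm (L - X n) \<le> sqrt ((r / 2)\<^sup>2)"
        unfolding norm_ell2_def minus_ell2.rep_eq L by (rule real_sqrt_le_mono)
      also have "\<dots> = r / 2" using \<open>r > 0\<close> by (intro real_sqrt_unique) auto
      finally show ?thesis using \<open>r > 0\<close> by (simp add: norm_minus_commute)
    qed
    thus "\<exists>N. \<forall>n\<ge>N. norm (X n - L) < r" by blast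
  qed
  thus "convergent X" by (auto simp: convergent_def)
qed


section \<open>The vector field\<close>

text \<open>Componentwise product; there is no unit.\<close>

instantiation ell2 :: times
begin
lift_definition times_ell2 :: "ell2 \<Rightarrow> ell2 \<Rightarrow> ell2" is "\<lambda>u v i. u i * v i"
  by (rule square_summable_mult)
instance ..
end

lift_definition Lap :: "ell2 \<Rightarrow> ell2" is "\<lambda>u i. - u (i - 1) + 2 * u i - u (i + 1)"
proof -
  fix u :: "int \<Rightarrow> real"
  assume u: "(\<lambda>i. (u i)\<^sup>2) summable_on UNIV"
  show "(\<lambda>i. (- u (i - 1) + 2 * u i - u (i + 1))\<^sup>2) summable_on UNIV"
    using square_summable_diff[OF square_summable_add[OF
          square_summable_scale[OF square_summable_shift[OF u, of "-1"], of "-1"]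
          square_summable_scale[OF u, of 2]] square_summable_shift[OF u, of 1]]
    by simp
qed

lift_definition Dminus :: "ell2 \<Rightarrow> ell2" is "\<lambda>u i. u (i - 1) - u i"
proof -
  fix u :: "int \<Rightarrow> real"
  assume u: "(\<lambda>i. (u i)\<^sup>2) summable_on UNIV"
  show "(\<lambda>i. (u (i - 1) - u i)\<^sup>2) summable_on UNIV"
    using square_summable_diff[OF square_summable_shift[OF u, of "-1"] u] by simp
qed

text \<open>
  The term \<open>u (1 - u) (u - \<gamma>)\<close>. The constant sequences 1 and \<open>\<gamma>\<close> are not
  square-summable, so the product is formed at the level of coordinates.
\<close>

lift_definition reaction :: "real \<Rightarrow> ell2 \<Rightarrow> ell2" is "\<lambda>\<gamma> u i. u i * (1 - u i) * (u i - \<gamma>)"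
proof -
  fix \<gamma> :: real and u :: "int \<Rightarrow> real"
  assume u: "(\<lambda>i. (u i)\<^sup>2) summable_on UNIV"
  obtain C where C: "\<And>i. \<bar>u i\<bar> \<le> C"
    using square_summable_imp_bounded[OF u] by blast
  have "\<bar>(1 - u i) * (u i - \<gamma>)\<bar> \<le> (1 + C) * (C + \<bar>\<gamma>\<bar>)" for i
    unfolding abs_mult by (intro mult_mono) (use C[of i] in auto)
  from square_summable_bounded_mult[OF u this]
  show "(\<lambda>i. (u i * (1 - u i) * (u i - \<gamma>))\<^sup>2) summable_on UNIV"
    by (simp add: mult.assoc)
qed

definition vfield :: "real \<Rightarrow> real \<Rightarrow> real \<Rightarrow> real \<Rightarrow> real \<Rightarrow> ell2 \<Rightarrow> ell2 \<Rightarrow> ell2"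
  where "vfield \<alpha> \<beta> \<gamma> \<nu> lam f u =
    \<nu> *\<^sub>R Lap u - \<alpha> *\<^sub>R (u * Dminus u) + \<beta> *\<^sub>R reaction \<gamma> u - lam *\<^sub>R u + f"


section \<open>Constants\<close>

definition lambda_star :: "real \<Rightarrow> real \<Rightarrow> real \<Rightarrow> real \<Rightarrow> real"
  where "lambda_star \<alpha> \<beta> \<gamma> \<nu> = 4 * \<nu> + (2 * \<alpha> + \<beta> + \<beta> * \<gamma>)\<^sup>2 / (4 * \<beta>) - \<beta> * \<gamma>"

definition M_const :: "real \<Rightarrow> real \<Rightarrow> real \<Rightarrow> real \<Rightarrow> real \<Rightarrow> ell2 \<Rightarrow> real \<Rightarrow> real"
  where "M_const \<alpha> \<beta> \<gamma> \<nu> lam f r =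
    \<beta> * r ^ 3 + (2 * \<alpha> + \<beta> + \<beta> * \<gamma>) * r\<^sup>2 + (4 * \<nu> + \<beta> * \<gamma> + lam) * r + norm f"

definition L_const :: "real \<Rightarrow> real \<Rightarrow> real \<Rightarrow> real \<Rightarrow> real \<Rightarrow> real \<Rightarrow> real"
  where "L_const \<alpha> \<beta> \<gamma> \<nu> lam r =
    4 * \<nu> + 2 * sqrt 5 * r * \<alpha>
      + sqrt (12 * r\<^sup>2 * (1 + \<gamma>)\<^sup>2 + 27 * r ^ 4 + 3 * \<gamma>\<^sup>2) * \<beta> + lam"

definition r_star :: "real \<Rightarrow> real \<Rightarrow> real \<Rightarrow> real \<Rightarrow> real \<Rightarrow> ell2 \<Rightarrow> real"
  where "r_star \<alpha> \<beta> \<gamma> \<nu> lam f = 1 + norm f / (lam - lambda_star \<alpha> \<beta> \<gamma> \<nu>)"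

definition eps_star :: "real \<Rightarrow> real \<Rightarrow> real \<Rightarrow> real \<Rightarrow> real \<Rightarrow> ell2 \<Rightarrow> real"
  where "eps_star \<alpha> \<beta> \<gamma> \<nu> lam f =
    min (1 / M_const \<alpha> \<beta> \<gamma> \<nu> lam f (r_star \<alpha> \<beta> \<gamma> \<nu> lam f + 1))
        (1 / (1 + L_const \<alpha> \<beta> \<gamma> \<nu> lam (r_star \<alpha> \<beta> \<gamma> \<nu> lam f + 1)))"

abbreviation B_star :: "real \<Rightarrow> real \<Rightarrow> real \<Rightarrow> real \<Rightarrow> real \<Rightarrow> ell2 \<Rightarrow> ell2 set"
  where "B_star \<alpha> \<beta> \<gamma> \<nu> lam f \<equiv> cball 0 (r_star \<alpha> \<beta> \<gamma> \<nu> lam f)"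


section \<open>The implicit Euler scheme and its numerical attractors\<close>

definition euler_solution ::
    "real \<Rightarrow> real \<Rightarrow> real \<Rightarrow> real \<Rightarrow> real \<Rightarrow> ell2 \<Rightarrow> real \<Rightarrow> ell2 \<Rightarrow> (nat \<Rightarrow> ell2) \<Rightarrow> bool"
  where "euler_solution \<alpha> \<beta> \<gamma> \<nu> lam f \<epsilon> y u \<longleftrightarrow>
    u 0 = y \<and> (\<forall>n. u n \<in> B_star \<alpha> \<beta> \<gamma> \<nu> lam f) \<and>
    (\<forall>n\<ge>1. u n = u (n - 1) + \<epsilon> *\<^sub>R vfield \<alpha> \<beta> \<gamma> \<nu> lam f (u n))"

text \<open>
  The discrete dynamical system \<open>S\<^sub>\<epsilon>(n)\<close>. Its value is meaningful only for
  \<open>y\<close> in the ball \<open>B_star\<close>, where for \<open>0 < \<epsilon> \<le> eps_star\<close> (and \<open>lam > lambda_star\<close>)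
  the scheme has exactly one solution in that ball.
\<close>

definition euler_map ::
    "real \<Rightarrow> real \<Rightarrow> real \<Rightarrow> real \<Rightarrow> real \<Rightarrow> ell2 \<Rightarrow> real \<Rightarrow> nat \<Rightarrow> ell2 \<Rightarrow> ell2"
  where "euler_map \<alpha> \<beta> \<gamma> \<nu> lam f \<epsilon> n y = (THE u. euler_solution \<alpha> \<beta> \<gamma> \<nu> lam f \<epsilon> y u) n"

text \<open>
  The semi-distance takes values in \<open>[0, \<infinity>]\<close>, so that the infimum over the empty set is
  \<open>\<infinity>\<close>; in particular the empty set attracts no nonempty set. (With a real-valued infimum
  the value at the empty set would be a meaningless default.)
\<close>

definition hausdorff_semidist :: "'a::metric_space set \<Rightarrow> 'a set \<Rightarrow> ennreal"
  where "hausdorff_semidist A B = (SUP a\<in>A. INF b\<in>B. ennreal (dist a b))"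

definition numerical_attractor ::
    "real \<Rightarrow> real \<Rightarrow> real \<Rightarrow> real \<Rightarrow> real \<Rightarrow> ell2 \<Rightarrow> real \<Rightarrow> ell2 set \<Rightarrow> bool"
  where "numerical_attractor \<alpha> \<beta> \<gamma> \<nu> lam f \<epsilon> A \<longleftrightarrow>
    compact A \<and> A \<subseteq> B_star \<alpha> \<beta> \<gamma> \<nu> lam f \<and>
    (\<forall>n. euler_map \<alpha> \<beta> \<gamma> \<nu> lam f \<epsilon> n ` A = A) \<and>
    (\<lambda>n. hausdorff_semidist (euler_map \<alpha> \<beta> \<gamma> \<nu> lam f \<epsilon> n ` B_star \<alpha> \<beta> \<gamma> \<nu> lam f) A)
      \<longlonglongrightarrow> 0"

end

theory Submission
  imports Defs
begin

text \<open>
  Write \<open>c = lam - lambda_star\<close>. Multiplying one step \<open>x = y + \<epsilon> F x\<close> componentwise by \<open>\<xi>\<^sub>i x\<^sub>i\<close> with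
  weights \<open>0 \<le> \<xi> \<le> 1\<close> that vary by at most \<open>\<delta>\<close> between neighbours and using Young's inequality gives
  \<open>(1 + \<epsilon> c) \<Sum> \<xi>\<^sub>i x\<^sub>i\<^sup>2 \<le> \<Sum> \<xi>\<^sub>i y\<^sub>i\<^sup>2 + \<epsilon>/c \<Sum> \<xi>\<^sub>i f\<^sub>i\<^sup>2 + O(\<epsilon> \<delta>)\<close>.
  With \<open>\<xi> = 1\<close> this confines the fixed point of Banach's theorem in the ball of radius
  \<open>r_star + 1\<close> to the ball of radius \<open>r_star\<close>. With \<open>\<xi>\<close> vanishing on a large finite set and equal to 1
  off a larger one, iteration makes the tails of \<open>S\<^sub>\<epsilon>(n) y\<close> small uniformly in \<open>y\<close>, so the sets
  \<open>S\<^sub>\<epsilon>(n) B\<close>, which decrease in \<open>n\<close>, are eventually covered by finitely many balls of any given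
  radius. The intersection of their closures is then compact, invariant and attracting.
\<close>

section \<open>Attractors of asymptotically compact maps\<close>

text \<open>Replaces the extended-valued limit by a quantified distance condition. The two sides
  also agree for empty \<open>A\<close>: an infimum over the empty set is infinite, and no nearby
  point \<open>b\<close> exists.\<close>

lemma hausdorff_semidist_tendsto_0_iff:
  "((\<lambda>n. hausdorff_semidist (X n) A) \<longlongrightarrow> 0) F \<longleftrightarrow>
    (\<forall>e>0. \<forall>\<^sub>F n in F. \<forall>a\<in>X n. \<exists>b\<in>A. dist a b < e)"
proof (intro iffI allI impI)
  fix e :: real
  assume "((\<lambda>n. hausdorff_semidist (X n) A) \<longlongrightarrow> 0) F" "e > 0"
  hence "\<forall>\<^sub>F n in F. hausdorff_semidist (X n) A < ennreal e"
    by (intro order_tendstoD(2)) auto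
  thus "\<forall>\<^sub>F n in F. \<forall>a\<in>X n. \<exists>b\<in>A. dist a b < e"
  proof eventually_elim
    case (elim n)
    show ?case
    proof
      fix a assume "a \<in> X n"
      hence "(INF b\<in>A. ennreal (dist a b)) \<le> hausdorff_semidist (X n) A"
        unfolding hausdorff_semidist_def by (rule SUP_upper)
      also note elim
      finally show "\<exists>b\<in>A. dist a b < e"
        using \<open>e > 0\<close> by (auto simp: INF_less_iff ennreal_less_iff)
    qed
  qed
next
  assume *: "\<forall>e>0. \<forall>\<^sub>F n in F. \<forall>a\<in>X n. \<exists>b\<in>A. dist a b < e"
  show "((\<lambda>n. hausdorff_semidist (X n) A) \<longlongrightarrow> 0) F"
  proof (rule order_tendstoI)
    fix e :: ennreal assume "0 < e"
    \<comment> \<open>A supremum of values below a bound may reach it, so a level strictly below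
      \<open>e\<close> is used.\<close>
    then obtain d where d: "0 < d" "d < e" using dense by blast
    then obtain r where r: "d = ennreal r" "r > 0"
      by (cases d) auto
    have "\<forall>\<^sub>F n in F. \<forall>a\<in>X n. \<exists>b\<in>A. dist a b < r" using * r by blast
    thus "\<forall>\<^sub>F n in F. hausdorff_semidist (X n) A < e"
    proof eventually_elim
      case (elim n)
      have "hausdorff_semidist (X n) A \<le> d"
        unfolding hausdorff_semidist_def
      proof (rule SUP_least)
        fix a assume "a \<in> X n"
        then obtain b where "b \<in> A" "dist a b < r" using elim by blast
        thus "(INF b\<in>A. ennreal (dist a b)) \<le> d"
          by (intro INF_lower2[of b]) (auto simp: r intro: ennreal_leI)
      qed
      with d show ?case by simp
    qed
  qed auto
qed

text \<open>Asymptotic compactness is expressed by \<open>finite_cover\<close>: one iterate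
  \<open>N\<close> per radius suffices, because the iterated images of \<open>B\<close> are nested
  and later ones inherit the cover.\<close>

locale asymptotically_compact_map =
  fixes T :: "'a::complete_space \<Rightarrow> 'a" and B :: "'a set"
  assumes closed_B: "closed B"
    and maps_B: "T ` B \<subseteq> B"
    and continuous_T: "continuous_on B T"
    and finite_cover: "e > 0 \<Longrightarrow> \<exists>N K. finite K \<and> (T ^^ N) ` B \<subseteq> (\<Union>c\<in>K. ball c e)"
begin

definition attractor :: "'a set"
  where "attractor = (\<Inter>n. closure ((T ^^ n) ` B))"

lemma iterate_in_B: "x \<in> B \<Longrightarrow> (T ^^ n) x \<in> B"
  using maps_B by (induction n) auto

lemma iterate_antimono: "m \<le> n \<Longrightarrow> (T ^^ n) ` B \<subseteq> (T ^^ m) ` B"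
proof -
  assume "m \<le> n"
  then obtain k where k: "n = m + k" using le_Suc_ex by blast
  show ?thesis by (auto simp: k funpow_add iterate_in_B)
qed

lemma closure_iterate_subset: "closure ((T ^^ n) ` B) \<subseteq> B"
  using iterate_in_B closed_B by (intro closure_minimal) auto

lemma attractor_subset: "attractor \<subseteq> B"
  unfolding attractor_def using closure_iterate_subset[of 0] by blast

text \<open>The compactness principle behind everything below. For each radius, all but finitely
  many terms lie in one finitely covered image, so the range is totally bounded; a limit lies in
  every closure because the closures are nested. Asking only for membership in closures lets the
  lemma serve both points of the attractor and points of the images.\<close>

lemma convergent_subsequence:
  assumes x: "\<And>n. x n \<in> closure ((T ^^ n) ` B)"
  obtains l r where "l \<in> attractor" "strict_mono r" "(x \<circ> r) \<longlonglongrightarrow> l"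
proof -
  have "compact (closure (range x))"
    unfolding compact_eq_totally_bounded
  proof (intro conjI allI impI)
    show "complete (closure (range x))" by (simp add: complete_eq_closed)
    fix e :: real assume "e > 0"
    then obtain N K where K: "finite K" "(T ^^ N) ` B \<subseteq> (\<Union>c\<in>K. ball c (e/2))"
      using finite_cover[of "e/2"] by auto
    \<comment> \<open>The cover says nothing about the first \<open>N\<close> terms, so they become
      centres themselves. Closed balls of radius \<open>e/2\<close> survive taking closures and
      still fit into open balls of radius \<open>e\<close>.\<close>
    define K' where "K' = K \<union> x ` {..<N}"
    have fin: "finite K'" using K by (simp add: K'_def)
    have closed: "closed (\<Union>c\<in>K'. cball c (e/2))" using fin by (intro closed_UN) auto
    have "closure ((T ^^ N) ` B) \<subseteq> (\<Union>c\<in>K'. cball c (e/2))"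
      by (rule closure_minimal[OF _ closed]) (use K(2) in \<open>force simp: K'_def\<close>)
    moreover have "x n \<in> closure ((T ^^ N) ` B)" if "n \<ge> N" for n
      using x[of n] closure_mono[OF iterate_antimono[OF that]] by auto
    moreover have "x n \<in> (\<Union>c\<in>K'. cball c (e/2))" if "n < N" for n
      using that \<open>e > 0\<close> by (intro UN_I[of "x n"]) (auto simp: K'_def)
    ultimately have "range x \<subseteq> (\<Union>c\<in>K'. cball c (e/2))"
      by (metis image_subsetI linorder_not_less subsetD)
    hence "closure (range x) \<subseteq> (\<Union>c\<in>K'. cball c (e/2))"
      by (intro closure_minimal closed)
    also have "\<dots> \<subseteq> (\<Union>c\<in>K'. ball c e)" using \<open>e > 0\<close> by force
    finally show "\<exists>k. finite k \<and> closure (range x) \<subseteq> (\<Union>c\<in>k. ball c e)" using fin by blast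
  qed
  hence "seq_compact (closure (range x))" by (rule compact_imp_seq_compact)
  moreover have "\<forall>n. x n \<in> closure (range x)" using closure_subset[of "range x"] by auto
  ultimately obtain l r where lr: "strict_mono r" "(x \<circ> r) \<longlonglongrightarrow> l"
    by (rule seq_compactE)
  have "l \<in> closure ((T ^^ m) ` B)" for m
  proof (rule Lim_in_closed_set[OF _ _ _ lr(2)])
    show "\<forall>\<^sub>F n in sequentially. (x \<circ> r) n \<in> closure ((T ^^ m) ` B)"
    proof (rule eventually_sequentiallyI)
      fix n assume "m \<le> n"
      hence "m \<le> r n" using seq_suble[OF lr(1), of n] by linarith
      thus "(x \<circ> r) n \<in> closure ((T ^^ m) ` B)"
        using x[of "r n"] closure_mono[OF iterate_antimono] by auto
    qed
  qed auto
  thus ?thesis using that lr by (auto simp: attractor_def)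
qed

lemma compact_attractor: "compact attractor"
  unfolding compact_eq_seq_compact_metric seq_compact_def
proof (intro allI impI)
  fix x :: "nat \<Rightarrow> 'a" assume "\<forall>n. x n \<in> attractor"
  hence "x n \<in> closure ((T ^^ n) ` B)" for n by (auto simp: attractor_def)
  then obtain l r where "l \<in> attractor" "strict_mono r" "(x \<circ> r) \<longlonglongrightarrow> l"
    by (rule convergent_subsequence)
  thus "\<exists>l\<in>attractor. \<exists>r. strict_mono r \<and> (x \<circ> r) \<longlonglongrightarrow> l" by blast
qed

text \<open>Continuity carries closures of images forward, which gives one inclusion. For the other,
  approximate preimages of \<open>x\<close> are extracted along a convergent subsequence, and
  continuity at its limit turns them into an exact preimage.\<close>

lemma image_attractor: "T ` attractor = attractor"
proof (intro equalityI subsetI)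
  fix y assume "y \<in> T ` attractor"
  then obtain x where x: "x \<in> attractor" "y = T x" by blast
  have "T x \<in> closure ((T ^^ n) ` B)" for n
  proof -
    have "T ` closure ((T ^^ n) ` B) \<subseteq> closure ((T ^^ Suc n) ` B)"
      using continuous_on_subset[OF continuous_T closure_iterate_subset[of n]]
    proof (rule image_closure_subset)
      have "T ` (T ^^ n) ` B = (T ^^ Suc n) ` B" by (simp add: image_image)
      thus "T ` (T ^^ n) ` B \<subseteq> closure ((T ^^ Suc n) ` B)" using closure_subset by metis
    qed simp
    also have "\<dots> \<subseteq> closure ((T ^^ n) ` B)" by (intro closure_mono iterate_antimono) simp
    finally show ?thesis using x(1) unfolding attractor_def by blast
  qed
  thus "y \<in> attractor" using x by (auto simp: attractor_def)
next
  fix x assume x: "x \<in> attractor"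
  \<comment> \<open>Stage \<open>Suc n\<close> of the intersection is used, so that the approximate
    preimage still lies in the \<open>n\<close>-th image and its limit lands in the
    attractor.\<close>
  have "\<exists>z\<in>(T ^^ n) ` B. dist (T z) x < inverse (Suc n)" for n
  proof -
    have "x \<in> closure ((T ^^ Suc n) ` B)" using x unfolding attractor_def by blast
    moreover have "0 < inverse (real (Suc n))" by simp
    ultimately obtain w where "w \<in> (T ^^ Suc n) ` B" "dist w x < inverse (Suc n)"
      unfolding closure_approachable by blast
    then obtain v where "v \<in> B" "dist (T ((T ^^ n) v)) x < inverse (Suc n)" by auto
    thus ?thesis by blast
  qed
  then obtain z where z: "\<And>n. z n \<in> (T ^^ n) ` B" "\<And>n. dist (T (z n)) x < inverse (Suc n)"
    by metis
  from z(1) obtain l r where lr: "l \<in> attractor" "strict_mono r" "(z \<circ> r) \<longlonglongrightarrow> l"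
    using closure_subset by (elim convergent_subsequence[of z, rotated]) blast
  have "(\<lambda>n. T ((z \<circ> r) n)) \<longlonglongrightarrow> T l"
    using continuous_T lr(3)
  proof (rule continuous_on_tendsto_compose)
    show "l \<in> B" using lr(1) attractor_subset by blast
    show "\<forall>\<^sub>F n in sequentially. (z \<circ> r) n \<in> B"
      using z(1) iterate_antimono[of 0] by (intro always_eventually) auto
  qed
  moreover have "(\<lambda>n. T (z n)) \<longlonglongrightarrow> x"
    by (rule metric_tendsto_imp_tendsto[OF LIMSEQ_inverse_real_of_nat])
       (use z(2) in \<open>auto intro!: always_eventually less_imp_le simp: dist_real_def\<close>)
  from LIMSEQ_subseq_LIMSEQ[OF this lr(2)]
  have "(\<lambda>n. T ((z \<circ> r) n)) \<longlonglongrightarrow> x" by (simp add: o_def)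
  ultimately have "T l = x" by (rule LIMSEQ_unique)
  thus "x \<in> T ` attractor" using lr(1) by blast
qed

lemma iterate_image_invariant: "T ` A = A \<Longrightarrow> (T ^^ n) ` A = A"
proof (induction n)
  case (Suc n)
  have "(T ^^ Suc n) ` A = T ` (T ^^ n) ` A" by (simp add: image_image)
  with Suc show ?case by simp
qed simp

lemma attractor_attracts:
  "(\<lambda>n. hausdorff_semidist ((T ^^ n) ` B) attractor) \<longlonglongrightarrow> 0"
  unfolding hausdorff_semidist_tendsto_0_iff
proof (rule ccontr)
  assume "\<not> (\<forall>e>0. \<forall>\<^sub>F n in sequentially. \<forall>a\<in>(T ^^ n) ` B. \<exists>b\<in>attractor. dist a b < e)"
  then obtain e where e: "e > 0"
      "\<And>m. \<exists>n\<ge>m. \<exists>a\<in>(T ^^ n) ` B. \<forall>b\<in>attractor. dist a b \<ge> e"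
    unfolding eventually_sequentially by (meson not_less)
  \<comment> \<open>Nestedness moves a bad point from a later stage back to stage \<open>m\<close>,
    giving a bad sequence without gaps in its index; its subsequential limit would be a point of the
    attractor.\<close>
  have "\<exists>a\<in>(T ^^ m) ` B. \<forall>b\<in>attractor. dist a b \<ge> e" for m
    using e(2)[of m] iterate_antimono[of m] by blast
  then obtain x where x: "\<And>n. x n \<in> (T ^^ n) ` B" "\<And>n b. b \<in> attractor \<Longrightarrow> dist (x n) b \<ge> e"
    by metis
  from x(1) obtain l r where lr: "l \<in> attractor" "strict_mono r" "(x \<circ> r) \<longlonglongrightarrow> l"
    using closure_subset by (elim convergent_subsequence[of x, rotated]) blast
  obtain n where "dist ((x \<circ> r) n) l < e" using metric_LIMSEQ_D[OF lr(3) e(1)] by blast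
  with x(2)[OF lr(1), of "r n"] show False by simp
qed

text \<open>Invariance places each of the two sets in every iterated image of \<open>B\<close>.
  Hence \<open>A\<close> lies in the intersection of closures, while the attractor, sitting inside
  images attracted by \<open>A\<close>, lies in the closure of \<open>A\<close>.\<close>

lemma attractor_unique:
  assumes "closed A" "A \<subseteq> B" "T ` A = A"
    and attracts: "(\<lambda>n. hausdorff_semidist ((T ^^ n) ` B) A) \<longlonglongrightarrow> 0"
  shows "A = attractor"
proof
  have "A \<subseteq> (T ^^ n) ` B" for n
    using iterate_image_invariant[OF assms(3), of n] image_mono[OF assms(2)] by metis
  thus "A \<subseteq> attractor" using closure_subset by (fastforce simp: attractor_def)
  have "x \<in> closure A" if "x \<in> attractor" for x
    unfolding closure_approachable
  proof (intro allI impI)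
    fix e :: real assume "e > 0"
    then obtain n where "\<forall>a\<in>(T ^^ n) ` B. \<exists>b\<in>A. dist a b < e"
      using attracts unfolding hausdorff_semidist_tendsto_0_iff eventually_sequentially by blast
    moreover have "x \<in> (T ^^ n) ` B"
      using iterate_image_invariant[OF image_attractor, of n]
        image_mono[OF attractor_subset, of "T ^^ n"] that by auto
    ultimately show "\<exists>b\<in>A. dist b x < e" by (metis dist_commute)
  qed
  thus "attractor \<subseteq> A" using assms(1) by auto
qed

lemma attractor_eq_omega_limit: "attractor = (\<Inter>m. closure (\<Union>n\<in>{m..}. (T ^^ n) ` B))"
proof -
  have "(\<Union>n\<in>{m..}. (T ^^ n) ` B) = (T ^^ m) ` B" for m
    using iterate_antimono[of m] by blast
  thus ?thesis by (simp add: attractor_def)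
qed

end

section \<open>Bounds for the vector field\<close>

lemma norm_ell2_power2: "(norm u)\<^sup>2 = (\<Sum>\<^sub>\<infinity>i. (coord u i)\<^sup>2)"
  by (simp add: norm_ell2_def infsum_nonneg)

lemma norm_ell2_le:
  assumes "0 \<le> c" "\<And>i. \<bar>coord u i\<bar> \<le> c * \<bar>coord v i\<bar>"
  shows "norm u \<le> c * norm v"
proof (rule power2_le_imp_le)
  have "(coord u i)\<^sup>2 \<le> c\<^sup>2 * (coord v i)\<^sup>2" for i
    using power_mono[OF assms(2)[of i], of 2] by (simp add: power_mult_distrib)
  hence "(norm u)\<^sup>2 \<le> (\<Sum>\<^sub>\<infinity>i. c\<^sup>2 * (coord v i)\<^sup>2)"
    unfolding norm_ell2_power2
    by (intro infsum_mono summable_on_cmult_right square_summable_coord)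
  thus "(norm u)\<^sup>2 \<le> (c * norm v)\<^sup>2"
    by (simp add: power_mult_distrib norm_ell2_power2 infsum_cmult_right square_summable_coord)
qed (use assms in simp)

text \<open>Translations are isometries, so writing the difference operators through them yields the
  operator bounds 4 and 2 from the triangle inequality alone.\<close>

lift_definition shift :: "int \<Rightarrow> ell2 \<Rightarrow> ell2" is "\<lambda>k u i. u (i + k)"
  by (rule square_summable_shift)

lemma bij_betw_int_shift: "bij_betw (\<lambda>i. i + k) UNIV (UNIV :: int set)"
  by (rule bij_betw_byWitness[of _ "\<lambda>i. i - k"]) auto

lemma norm_shift [simp]: "norm (shift k u) = norm u"
  using infsum_reindex_bij_betw[OF bij_betw_int_shift, of "\<lambda>i. (coord u i)\<^sup>2" k]
  by (simp add: norm_ell2_def shift.rep_eq)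

lemma Lap_eq_shift: "Lap u = 2 *\<^sub>R u - shift (-1) u - shift 1 u"
  by (rule coord_inject[THEN iffD1])
     (simp add: Lap.rep_eq shift.rep_eq minus_ell2.rep_eq scaleR_ell2.rep_eq fun_eq_iff)

lemma Dminus_eq_shift: "Dminus u = shift (-1) u - u"
  by (rule coord_inject[THEN iffD1])
     (simp add: Dminus.rep_eq shift.rep_eq minus_ell2.rep_eq fun_eq_iff)

lemma norm_Lap_le: "norm (Lap u) \<le> 4 * norm u"
proof -
  have "norm (Lap u) \<le> norm (2 *\<^sub>R u) + norm (shift (-1) u) + norm (shift 1 u)"
    unfolding Lap_eq_shift by (meson add_right_mono norm_triangle_ineq4 order_trans)
  thus ?thesis by simp
qed

lemma norm_Dminus_le: "norm (Dminus u) \<le> 2 * norm u"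
  using norm_triangle_ineq4[of "shift (-1) u" u] by (simp add: Dminus_eq_shift)

lemma norm_times_ell2_le:
  assumes "\<And>i. \<bar>coord u i\<bar> \<le> c"
  shows "norm (u * v) \<le> c * norm v"
proof (rule norm_ell2_le)
  show "0 \<le> c" using assms[of 0] by linarith
  show "\<bar>coord (u * v) i\<bar> \<le> c * \<bar>coord v i\<bar>" for i
    using mult_right_mono[OF assms, of "\<bar>coord v i\<bar>"] by (simp add: times_ell2.rep_eq abs_mult)
qed

lemma Lap_diff: "Lap (u - v) = Lap u - Lap v"
  by (rule coord_inject[THEN iffD1]) (simp add: Lap.rep_eq minus_ell2.rep_eq fun_eq_iff)

text \<open>In each product of this splitting one factor is bounded in the sup norm and the other is
  linear in \<open>u - v\<close>.\<close>

lemma convection_diff: "u * Dminus u - v * Dminus v = Dminus u * (u - v) + v * Dminus (u - v)"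
  by (rule coord_inject[THEN iffD1])
     (simp add: Dminus.rep_eq minus_ell2.rep_eq plus_ell2.rep_eq times_ell2.rep_eq fun_eq_iff algebra_simps)

lemma abs_coord_le: "norm u \<le> r \<Longrightarrow> \<bar>coord u i\<bar> \<le> r"
  using abs_coord_le_norm order_trans by blast

lemma abs_coord_Dminus_le:
  assumes "norm u \<le> r"
  shows "\<bar>coord (Dminus u) i\<bar> \<le> 2 * r"
  using abs_coord_le[OF assms, of i] abs_coord_le[OF assms, of "i - 1"]
  by (simp add: Dminus.rep_eq)

lemma norm_convection_diff_le:
  assumes "norm u \<le> r" "norm v \<le> r"
  shows "norm (u * Dminus u - v * Dminus v) \<le> 4 * r * norm (u - v)"
proof -
  have "0 \<le> r" using assms(1) norm_ge_zero order_trans by blast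
  have "norm (Dminus u * (u - v)) \<le> (2 * r) * norm (u - v)"
    by (rule norm_times_ell2_le) (rule abs_coord_Dminus_le[OF assms(1)])
  moreover have "norm (v * Dminus (u - v)) \<le> r * norm (Dminus (u - v))"
    by (rule norm_times_ell2_le) (rule abs_coord_le[OF assms(2)])
  moreover have "r * norm (Dminus (u - v)) \<le> r * (2 * norm (u - v))"
    using norm_Dminus_le \<open>0 \<le> r\<close> by (rule mult_left_mono)
  ultimately show ?thesis
    unfolding convection_diff using norm_triangle_ineq[of "Dminus u * (u - v)" "v * Dminus (u - v)"]
    by linarith
qed

text \<open>The reaction acts coordinatewise as a cubic, so its difference factors through
  \<open>a - b\<close>; the quotient is a quadratic form in two numbers bounded by
  \<open>r\<close>.\<close>

lemma norm_reaction_diff_le: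
  assumes "0 < \<gamma>" "norm u \<le> r" "norm v \<le> r"
  shows "norm (reaction \<gamma> u - reaction \<gamma> v) \<le> (3 * r\<^sup>2 + 2 * r * (1 + \<gamma>) + \<gamma>) * norm (u - v)"
proof (rule norm_ell2_le)
  have "0 \<le> r" using assms(2) norm_ge_zero order_trans by blast
  thus "0 \<le> 3 * r\<^sup>2 + 2 * r * (1 + \<gamma>) + \<gamma>" using assms by simp
  fix i
  let ?a = "coord u i" and ?b = "coord v i"
  have ab: "\<bar>?a\<bar> \<le> r" "\<bar>?b\<bar> \<le> r" using assms abs_coord_le by auto
  have "\<bar>?a\<^sup>2 + ?a * ?b + ?b\<^sup>2\<bar> \<le> 3 * r\<^sup>2"
  proof -
    have "?a\<^sup>2 \<le> r\<^sup>2" "?b\<^sup>2 \<le> r\<^sup>2" using power_mono[OF ab(1), of 2] power_mono[OF ab(2), of 2] by auto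
    moreover have "\<bar>?a * ?b\<bar> \<le> r\<^sup>2"
      using mult_mono[OF ab] \<open>0 \<le> r\<close> by (simp add: abs_mult power2_eq_square)
    ultimately show ?thesis using zero_le_power2[of ?a] zero_le_power2[of ?b] by linarith
  qed
  moreover have "\<bar>(1 + \<gamma>) * (?a + ?b)\<bar> \<le> 2 * r * (1 + \<gamma>)"
    using mult_left_mono[of "\<bar>?a + ?b\<bar>" "2 * r" "1 + \<gamma>"] ab assms(1) by (simp add: abs_mult mult_ac)
  ultimately have *: "\<bar>- (?a\<^sup>2 + ?a * ?b + ?b\<^sup>2) + (1 + \<gamma>) * (?a + ?b) - \<gamma>\<bar>
      \<le> 3 * r\<^sup>2 + 2 * r * (1 + \<gamma>) + \<gamma>" using assms(1) by linarith
  have "coord (reaction \<gamma> u - reaction \<gamma> v) i =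
      (- (?a\<^sup>2 + ?a * ?b + ?b\<^sup>2) + (1 + \<gamma>) * (?a + ?b) - \<gamma>) * (?a - ?b)"
    by (simp add: minus_ell2.rep_eq reaction.rep_eq) algebra
  with mult_right_mono[OF *, of "\<bar>?a - ?b\<bar>"]
  show "\<bar>coord (reaction \<gamma> u - reaction \<gamma> v) i\<bar>
      \<le> (3 * r\<^sup>2 + 2 * r * (1 + \<gamma>) + \<gamma>) * \<bar>coord (u - v) i\<bar>"
    by (simp add: abs_mult minus_ell2.rep_eq)
qed

lemma norm_reaction_le:
  assumes "0 < \<gamma>" "norm u \<le> r"
  shows "norm (reaction \<gamma> u) \<le> (1 + r) * (r + \<gamma>) * r"
proof -
  have "0 \<le> r" using assms(2) norm_ge_zero order_trans by blast
  have "norm (reaction \<gamma> u) \<le> (1 + r) * (r + \<gamma>) * norm u"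
  proof (rule norm_ell2_le)
    show "0 \<le> (1 + r) * (r + \<gamma>)" using \<open>0 \<le> r\<close> assms by simp
    fix i
    have "\<bar>coord u i\<bar> \<le> r" using assms abs_coord_le by auto
    hence "\<bar>1 - coord u i\<bar> * \<bar>coord u i - \<gamma>\<bar> \<le> (1 + r) * (r + \<gamma>)"
      using \<open>0 \<le> r\<close> assms(1) by (intro mult_mono) auto
    from mult_right_mono[OF this, of "\<bar>coord u i\<bar>"]
    show "\<bar>coord (reaction \<gamma> u) i\<bar> \<le> (1 + r) * (r + \<gamma>) * \<bar>coord u i\<bar>"
      by (simp add: reaction.rep_eq abs_mult mult_ac)
  qed
  also have "\<dots> \<le> (1 + r) * (r + \<gamma>) * r"
    using \<open>0 \<le> r\<close> assms by (intro mult_left_mono) auto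
  finally show ?thesis .
qed

lemma norm_triangle_four:
  fixes a b c d :: "'a::real_normed_vector"
  shows "norm (a - b + c - d) \<le> norm a + norm b + norm c + norm d"
  using norm_triangle_ineq4[of "a - b + c" d] norm_triangle_ineq[of "a - b" c]
    norm_triangle_ineq4[of a b] by linarith

lemma norm_vfield_le:
  assumes "\<alpha> > 0" "\<beta> > 0" "\<nu> > 0" "lam > 0" "\<gamma> > 0" "norm u \<le> r"
  shows "norm (vfield \<alpha> \<beta> \<gamma> \<nu> lam f u) \<le> M_const \<alpha> \<beta> \<gamma> \<nu> lam f r"
proof -
  have "0 \<le> r" using assms(6) norm_ge_zero order_trans by blast
  have "norm (u * Dminus u) \<le> r * norm (Dminus u)"
    by (rule norm_times_ell2_le) (rule abs_coord_le[OF assms(6)])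
  also have "\<dots> \<le> r * (2 * r)"
    using norm_Dminus_le[of u] assms(6) \<open>0 \<le> r\<close> by (intro mult_left_mono) linarith+
  finally have "\<alpha> * norm (u * Dminus u) \<le> \<alpha> * (r * (2 * r))" using assms by simp
  moreover have "\<nu> * norm (Lap u) \<le> \<nu> * (4 * r)"
    using norm_Lap_le[of u] assms by (intro mult_left_mono) linarith+
  moreover have "\<beta> * norm (reaction \<gamma> u) \<le> \<beta> * ((1 + r) * (r + \<gamma>) * r)"
    using norm_reaction_le[of \<gamma> u r] assms by simp
  moreover have "lam * norm u \<le> lam * r" using assms by simp
  moreover have "norm (vfield \<alpha> \<beta> \<gamma> \<nu> lam f u) \<le> norm (\<nu> *\<^sub>R Lap u)
      + norm (\<alpha> *\<^sub>R (u * Dminus u)) + norm (\<beta> *\<^sub>R reaction \<gamma> u) + norm (lam *\<^sub>R u) + norm f"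
    unfolding vfield_def by (intro norm_triangle_mono norm_triangle_four order_refl)
  hence "norm (vfield \<alpha> \<beta> \<gamma> \<nu> lam f u) \<le> \<nu> * norm (Lap u)
      + \<alpha> * norm (u * Dminus u) + \<beta> * norm (reaction \<gamma> u) + lam * norm u + norm f"
    using assms by simp
  ultimately have "norm (vfield \<alpha> \<beta> \<gamma> \<nu> lam f u) \<le>
      \<nu> * (4 * r) + \<alpha> * (r * (2 * r)) + \<beta> * ((1 + r) * (r + \<gamma>) * r) + lam * r + norm f"
    by linarith
  also have "\<dots> = M_const \<alpha> \<beta> \<gamma> \<nu> lam f r"
    by (simp add: M_const_def power2_eq_square power3_eq_cube algebra_simps)
  finally show ?thesis .
qed

lemma vfield_lipschitz:
  assumes "\<alpha> > 0" "\<beta> > 0" "\<nu> > 0" "lam > 0" "\<gamma> > 0" "norm u \<le> r" "norm v \<le> r"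
  shows "norm (vfield \<alpha> \<beta> \<gamma> \<nu> lam f u - vfield \<alpha> \<beta> \<gamma> \<nu> lam f v)
    \<le> L_const \<alpha> \<beta> \<gamma> \<nu> lam r * norm (u - v)"
proof -
  have "0 \<le> r" using assms(6) norm_ge_zero order_trans by blast
  let ?w = "norm (u - v)"
  have "vfield \<alpha> \<beta> \<gamma> \<nu> lam f u - vfield \<alpha> \<beta> \<gamma> \<nu> lam f v =
      \<nu> *\<^sub>R Lap (u - v) - \<alpha> *\<^sub>R (u * Dminus u - v * Dminus v)
      + \<beta> *\<^sub>R (reaction \<gamma> u - reaction \<gamma> v) - lam *\<^sub>R (u - v)"
    by (simp add: vfield_def Lap_diff algebra_simps)
  also have "norm \<dots> \<le> norm (\<nu> *\<^sub>R Lap (u - v)) + norm (\<alpha> *\<^sub>R (u * Dminus u - v * Dminus v))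
      + norm (\<beta> *\<^sub>R (reaction \<gamma> u - reaction \<gamma> v)) + norm (lam *\<^sub>R (u - v))"
    by (rule norm_triangle_four)
  also have "\<dots> = \<nu> * norm (Lap (u - v)) + \<alpha> * norm (u * Dminus u - v * Dminus v)
      + \<beta> * norm (reaction \<gamma> u - reaction \<gamma> v) + lam * ?w" using assms by simp
  also have "\<dots> \<le> \<nu> * (4 * ?w) + \<alpha> * (4 * r * ?w)
      + \<beta> * ((3 * r\<^sup>2 + 2 * r * (1 + \<gamma>) + \<gamma>) * ?w) + lam * ?w"
    using assms norm_Lap_le[of "u - v"] norm_convection_diff_le[OF assms(6,7)]
      norm_reaction_diff_le[OF assms(5-7)]
    by (intro add_mono mult_left_mono order_refl) auto
  also have "\<dots> = (4 * \<nu> + 2 * 2 * r * \<alpha> + (3 * r\<^sup>2 + 2 * r * (1 + \<gamma>) + \<gamma>) * \<beta> + lam) * ?w"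
    by algebra
  also have "\<dots> \<le> L_const \<alpha> \<beta> \<gamma> \<nu> lam r * ?w"
  proof (rule mult_right_mono)
    \<comment> \<open>The constant 2 in place of \<open>sqrt 5\<close> already suffices; the other root is Cauchy-Schwarz.\<close>
    have "2 \<le> sqrt 5" by (rule real_le_rsqrt) simp
    hence "2 * 2 * r * \<alpha> \<le> 2 * sqrt 5 * r * \<alpha>"
      using \<open>0 \<le> r\<close> assms by (intro mult_right_mono mult_left_mono) auto
    moreover have "3 * r\<^sup>2 + 2 * r * (1 + \<gamma>) + \<gamma>
        \<le> sqrt (12 * r\<^sup>2 * (1 + \<gamma>)\<^sup>2 + 27 * r ^ 4 + 3 * \<gamma>\<^sup>2)"
    proof (rule real_le_rsqrt)
      have "(a + b + c)\<^sup>2 \<le> 3 * (a\<^sup>2 + b\<^sup>2 + c\<^sup>2)" for a b c :: real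
        using sum_squares_bound[of a b] sum_squares_bound[of b c] sum_squares_bound[of a c]
        by (simp add: power2_eq_square algebra_simps)
      from this[of "3 * r\<^sup>2" "2 * r * (1 + \<gamma>)" \<gamma>]
      show "(3 * r\<^sup>2 + 2 * r * (1 + \<gamma>) + \<gamma>)\<^sup>2 \<le> 12 * r\<^sup>2 * (1 + \<gamma>)\<^sup>2 + 27 * r ^ 4 + 3 * \<gamma>\<^sup>2"
        by (simp add: power_mult_distrib)
    qed
    hence "(3 * r\<^sup>2 + 2 * r * (1 + \<gamma>) + \<gamma>) * \<beta>
        \<le> sqrt (12 * r\<^sup>2 * (1 + \<gamma>)\<^sup>2 + 27 * r ^ 4 + 3 * \<gamma>\<^sup>2) * \<beta>" using assms by simp
    ultimately show "4 * \<nu> + 2 * 2 * r * \<alpha> + (3 * r\<^sup>2 + 2 * r * (1 + \<gamma>) + \<gamma>) * \<beta> + lam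
        \<le> L_const \<alpha> \<beta> \<gamma> \<nu> lam r"
      unfolding L_const_def by linarith
  qed simp
  finally show ?thesis .
qed

section \<open>Weighted energy estimates\<close>

text \<open>For weights between 0 and 1 this interpolates between the squared norm and the squared
  norm of a tail.\<close>

definition weighted_sum :: "(int \<Rightarrow> real) \<Rightarrow> ell2 \<Rightarrow> real"
  where "weighted_sum \<xi> u = (\<Sum>\<^sub>\<infinity>i. \<xi> i * (coord u i)\<^sup>2)"

lemma summable_on_weighted:
  fixes g :: "int \<Rightarrow> real"
  assumes "g summable_on UNIV" "\<And>i. 0 \<le> g i" "\<And>i. 0 \<le> \<xi> i" "\<And>i. \<xi> i \<le> 1"
  shows "(\<lambda>i. \<xi> i * g i) summable_on UNIV"
  using assms(1) by (rule summable_on_comparison_test) (auto simp: assms mult_left_le_one_le)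

text \<open>A discrete substitute for summation by parts: after reindexing, the weight is evaluated
  at the neighbour, and replacing it by the original weight costs at most \<open>\<delta>\<close>
  times the total mass of \<open>p\<close>.\<close>

lemma weighted_shift_has_sum:
  fixes p :: "int \<Rightarrow> real"
  assumes p: "p summable_on UNIV" "\<And>i. 0 \<le> p i"
    and \<xi>: "\<And>i. 0 \<le> \<xi> i" "\<And>i. \<xi> i \<le> 1" "\<And>i. \<xi> i \<le> \<xi> (i + k) + \<delta>"
  shows "\<exists>s. ((\<lambda>i. \<xi> i * p (i + k)) has_sum s) UNIV \<and> s \<le> (\<Sum>\<^sub>\<infinity>i. \<xi> i * p i) + \<delta> * (\<Sum>\<^sub>\<infinity>i. p i)"
proof -
  have "(\<lambda>i. p (i + k)) summable_on UNIV"
    using summable_on_reindex_bij_betw[OF bij_betw_int_shift, of p k] p(1) by simp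
  hence shifted: "(\<lambda>i. \<xi> i * p (i + k)) summable_on UNIV"
    using p \<xi> by (intro summable_on_weighted) auto
  have weighted: "(\<lambda>i. \<xi> i * p i) summable_on UNIV" using p \<xi> by (intro summable_on_weighted)
  have "((\<lambda>i. \<xi> (i + k) * p (i + k)) has_sum (\<Sum>\<^sub>\<infinity>i. \<xi> i * p i)) UNIV"
    "((\<lambda>i. p (i + k)) has_sum (\<Sum>\<^sub>\<infinity>i. p i)) UNIV"
    using has_sum_reindex_bij_betw[OF bij_betw_int_shift, of "\<lambda>i. \<xi> i * p i" k]
      has_sum_reindex_bij_betw[OF bij_betw_int_shift, of p k] p(1) weighted by auto
  hence "((\<lambda>i. \<xi> (i + k) * p (i + k) + \<delta> * p (i + k)) has_sum
      (\<Sum>\<^sub>\<infinity>i. \<xi> i * p i) + \<delta> * (\<Sum>\<^sub>\<infinity>i. p i)) UNIV"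
    by (intro has_sum_add has_sum_cmult_right)
  with has_sum_infsum[OF shifted]
  have "(\<Sum>\<^sub>\<infinity>i. \<xi> i * p (i + k)) \<le> (\<Sum>\<^sub>\<infinity>i. \<xi> i * p i) + \<delta> * (\<Sum>\<^sub>\<infinity>i. p i)"
  proof (rule has_sum_mono)
    show "\<xi> i * p (i + k) \<le> \<xi> (i + k) * p (i + k) + \<delta> * p (i + k)" for i
      using mult_right_mono[OF \<xi>(3)[of i] p(2)[of "i + k"]] by (simp add: distrib_right)
  qed
  with has_sum_infsum[OF shifted] show ?thesis by blast
qed

lemma weighted_sum_one: "weighted_sum (\<lambda>_. 1) u = (norm u)\<^sup>2"
  by (simp add: weighted_sum_def norm_ell2_power2)

lemma weighted_has_sum:
  assumes "\<And>i. 0 \<le> \<xi> i" "\<And>i. \<xi> i \<le> 1"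
  shows "((\<lambda>i. \<xi> i * (coord u i)\<^sup>2) has_sum weighted_sum \<xi> u) UNIV"
  unfolding weighted_sum_def
  by (intro has_sum_infsum summable_on_weighted assms square_summable_coord) simp

lemma weighted_sum_le_norm:
  assumes "\<And>i. 0 \<le> \<xi> i" "\<And>i. \<xi> i \<le> 1"
  shows "weighted_sum \<xi> u \<le> (norm u)\<^sup>2"
  unfolding weighted_sum_one[symmetric]
  by (rule has_sum_mono[OF weighted_has_sum[OF assms] weighted_has_sum])
     (use assms in \<open>auto simp: mult_left_le_one_le\<close>)

text \<open>
  Here \<open>a, b, d\<close> stand for \<open>u\<^sub>i, u\<^sub>i\<^sub>-\<^sub>1, u\<^sub>i\<^sub>+\<^sub>1\<close>. The two brackets at the end are discrete differences, so a
  slowly varying weight makes their sum small.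
\<close>

lemma energy_pointwise:
  fixes a b d g :: real
  assumes "\<alpha> > 0" "\<beta> > 0" "\<nu> > 0" "\<gamma> > 0"
  shows "a * (\<nu> * (- b + 2 * a - d) - \<alpha> * (a * (b - a)) + \<beta> * (a * (1 - a) * (a - \<gamma>)) - lam * a + g)
    \<le> - (lam - lambda_star \<alpha> \<beta> \<gamma> \<nu>) * a\<^sup>2 + g * a
      + (\<nu> / 2 * b\<^sup>2 + \<alpha> / 3 * \<bar>b\<bar> ^ 3 - (\<nu> / 2 * a\<^sup>2 + \<alpha> / 3 * \<bar>a\<bar> ^ 3))
      + (\<nu> / 2 * d\<^sup>2 - \<nu> / 2 * a\<^sup>2)"
proof -
  \<comment> \<open>Young's inequality with exponents 3/2 and 3. It turns the mixed convection term
    into pure cubes, so that \<open>\<alpha> / 3\<close> times a difference of cubes splits off and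
    \<open>2 * \<alpha>\<close> times a cube remains.\<close>
  have cubic: "3 * (x\<^sup>2 * y) \<le> 2 * x ^ 3 + y ^ 3" if "0 \<le> x" "0 \<le> y" for x y :: real
  proof -
    have "2 * x ^ 3 + y ^ 3 - 3 * (x\<^sup>2 * y) = (x - y)\<^sup>2 * (2 * x + y)"
      by (simp add: power2_eq_square power3_eq_cube algebra_simps)
    moreover have "0 \<le> (x - y)\<^sup>2 * (2 * x + y)" using that by simp
    ultimately show ?thesis by linarith
  qed
  let ?k = "2 * \<alpha> + \<beta> + \<beta> * \<gamma>"
  \<comment> \<open>\<open>Lap\<close> is a nonnegative operator and enters with a plus sign, so
    this term is not dissipative; after splitting off the differences it costs the
    \<open>4 * \<nu>\<close> in \<open>lambda_star\<close>.\<close>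
  have "\<nu> * (- a * b) \<le> \<nu> * ((a\<^sup>2 + b\<^sup>2) / 2)"
    using assms sum_squares_bound[of a "-b"] by (intro mult_left_mono) (simp_all add: algebra_simps)
  moreover have "\<nu> * (- a * d) \<le> \<nu> * ((a\<^sup>2 + d\<^sup>2) / 2)"
    using assms sum_squares_bound[of a "-d"] by (intro mult_left_mono) (simp_all add: algebra_simps)
  moreover have "\<alpha> * (- (a\<^sup>2 * b) + a ^ 3) \<le> \<alpha> * ((2 * \<bar>a\<bar> ^ 3 + \<bar>b\<bar> ^ 3) / 3 + \<bar>a\<bar> ^ 3)"
  proof (rule mult_left_mono)
    have "- (a\<^sup>2 * b) \<le> a\<^sup>2 * \<bar>b\<bar>" using mult_left_mono[of "- b" "\<bar>b\<bar>" "a\<^sup>2"] by simp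
    moreover have "a ^ 3 \<le> \<bar>a\<bar> ^ 3" by (metis abs_ge_self power_abs)
    ultimately show "- (a\<^sup>2 * b) + a ^ 3 \<le> (2 * \<bar>a\<bar> ^ 3 + \<bar>b\<bar> ^ 3) / 3 + \<bar>a\<bar> ^ 3"
      using cubic[OF abs_ge_zero abs_ge_zero, of a b] unfolding power2_abs by argo
  qed (use assms in simp)
  moreover have "\<beta> * (1 + \<gamma>) * a ^ 3 \<le> \<beta> * (1 + \<gamma>) * \<bar>a\<bar> ^ 3"
    using assms by (intro mult_left_mono) (auto simp flip: power_abs)
  \<comment> \<open>Completing the square: the quartic damping absorbs all cubic terms, and for
    \<open>k = ?k\<close> the price is the quotient in \<open>lambda_star\<close>.\<close>
  moreover have "k * \<bar>a\<bar> ^ 3 \<le> \<beta> * a ^ 4 + k\<^sup>2 / (4 * \<beta>) * a\<^sup>2" for k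
  proof -
    define m where "m = k / (2 * \<beta>)"
    have k: "k = 2 * \<beta> * m" "k\<^sup>2 / (4 * \<beta>) = \<beta> * m\<^sup>2"
      using assms(2) by (simp_all add: m_def power2_eq_square)
    have "0 \<le> \<beta> * (\<bar>a\<bar>\<^sup>2 - m * \<bar>a\<bar>)\<^sup>2" using assms by simp
    also have "\<dots> = \<beta> * \<bar>a\<bar> ^ 4 + \<beta> * m\<^sup>2 * \<bar>a\<bar>\<^sup>2 - k * \<bar>a\<bar> ^ 3"
      unfolding k(1) by algebra
    finally show ?thesis unfolding k(2) by simp
  qed
  note this[of ?k]
  moreover have "a * (\<nu> * (- b + 2 * a - d) - \<alpha> * (a * (b - a)) + \<beta> * (a * (1 - a) * (a - \<gamma>)) - lam * a + g)
     = \<nu> * (- a * b) + \<nu> * (- a * d) + 2 * \<nu> * a\<^sup>2 + \<alpha> * (- (a\<^sup>2 * b) + a ^ 3)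
       + \<beta> * (1 + \<gamma>) * a ^ 3 - \<beta> * a ^ 4 - \<beta> * \<gamma> * a\<^sup>2 - lam * a\<^sup>2 + g * a"
    by algebra
  moreover have "- (lam - lambda_star \<alpha> \<beta> \<gamma> \<nu>) * a\<^sup>2
      = - lam * a\<^sup>2 + 4 * (\<nu> * a\<^sup>2) + ?k\<^sup>2 / (4 * \<beta>) * a\<^sup>2 - \<beta> * \<gamma> * a\<^sup>2"
    unfolding lambda_star_def by (simp add: left_diff_distrib distrib_right)
  moreover have "?k * \<bar>a\<bar> ^ 3 = 2 * (\<alpha> * \<bar>a\<bar> ^ 3) + \<beta> * (1 + \<gamma>) * \<bar>a\<bar> ^ 3" by algebra
  ultimately show ?thesis by (simp add: distrib_left add_divide_distrib)
qed

text \<open>The scheme is tested with twice the weighted solution. Young's inequality moves half of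
  \<open>?x i * ?y i\<close> to the left, and half of the damping \<open>2 * \<epsilon> * c\<close>
  is spent on the forcing. What remains of the neighbour terms is proportional to the variation
  \<open>\<delta>\<close> of the weight.\<close>

lemma implicit_step_weighted:
  assumes "\<alpha> > 0" "\<beta> > 0" "\<nu> > 0" "\<gamma> > 0" "\<epsilon> > 0"
    and c: "c = lam - lambda_star \<alpha> \<beta> \<gamma> \<nu>" "c > 0"
    and step: "x = y + \<epsilon> *\<^sub>R vfield \<alpha> \<beta> \<gamma> \<nu> lam f x"
    and \<xi>: "\<And>i. 0 \<le> \<xi> i" "\<And>i. \<xi> i \<le> 1" "\<And>i. \<bar>\<xi> (i + 1) - \<xi> i\<bar> \<le> \<delta>"
    and r: "norm x \<le> r"
  shows "(1 + \<epsilon> * c) * weighted_sum \<xi> x \<le> weighted_sum \<xi> y + \<epsilon> / c * weighted_sum \<xi> f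
    + 2 * \<epsilon> * \<delta> * ((\<nu> + \<alpha> / 3 * r) * r\<^sup>2)"
proof -
  let ?x = "coord x" and ?y = "coord y" and ?f = "coord f"
  \<comment> \<open>\<open>p\<close> is exchanged with the left neighbour and contains the
    convective cube; \<open>q\<close> is exchanged with the right neighbour and is purely
    diffusive.\<close>
  define p where "p i = \<nu> / 2 * (?x i)\<^sup>2 + \<alpha> / 3 * \<bar>?x i\<bar> ^ 3" for i
  define q where "q i = \<nu> / 2 * (?x i)\<^sup>2" for i
  have "0 \<le> r" using r norm_ge_zero order_trans by blast
  have "0 \<le> \<delta>" using \<xi>(3)[of 0] by linarith
  have pointwise: "(1 + \<epsilon> * c) * (?x i)\<^sup>2 + 2 * \<epsilon> * (p i + q i)
      \<le> (?y i)\<^sup>2 + \<epsilon> / c * (?f i)\<^sup>2 + 2 * \<epsilon> * (p (i + (-1)) + q (i + 1))" for i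
  proof -
    define G where "G = \<nu> * (- ?x (i - 1) + 2 * ?x i - ?x (i + 1)) - \<alpha> * (?x i * (?x (i - 1) - ?x i))
       + \<beta> * (?x i * (1 - ?x i) * (?x i - \<gamma>)) - lam * ?x i + ?f i"
    have "?x i = ?y i + \<epsilon> * G"
      by (subst step) (simp add: G_def vfield_def plus_ell2.rep_eq minus_ell2.rep_eq
          scaleR_ell2.rep_eq times_ell2.rep_eq Lap.rep_eq Dminus.rep_eq reaction.rep_eq)
    hence "(?x i)\<^sup>2 = ?x i * ?y i + \<epsilon> * (?x i * G)"
      by (simp add: power2_eq_square algebra_simps)
    moreover have "?x i * ?y i \<le> ((?x i)\<^sup>2 + (?y i)\<^sup>2) / 2" using sum_squares_bound[of "?x i" "?y i"] by simp
    moreover have "?x i * G \<le> - c * (?x i)\<^sup>2 + ?f i * ?x i + (p (i + (-1)) - p i) + (q (i + 1) - q i)"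
      using energy_pointwise[OF assms(1-4), of "?x i" "?x (i - 1)" "?x (i + 1)" lam "?f i"]
      unfolding G_def p_def q_def c(1) by simp
    hence "\<epsilon> * (?x i * G) \<le> \<epsilon> * (- c * (?x i)\<^sup>2 + ?f i * ?x i + (p (i + (-1)) - p i) + (q (i + 1) - q i))"
      using assms by simp
    moreover have "\<epsilon> * (2 * (?f i * ?x i)) \<le> \<epsilon> * (c * (?x i)\<^sup>2 + (?f i)\<^sup>2 / c)"
    proof (rule mult_left_mono)
      have "0 \<le> c * (?x i - ?f i / c)\<^sup>2" using c by simp
      also have "\<dots> = c * (?x i)\<^sup>2 + (?f i)\<^sup>2 / c - 2 * (?f i * ?x i)"
        using c(2) by (simp add: power2_eq_square field_simps)
      finally show "2 * (?f i * ?x i) \<le> c * (?x i)\<^sup>2 + (?f i)\<^sup>2 / c" by simp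
    qed (use assms in simp)
    ultimately show ?thesis by (simp add: algebra_simps)
  qed
  \<comment> \<open>The sup bound trades one power of the cube for \<open>r\<close>, which makes
    \<open>p\<close> summable with total mass controlled by the squared norm.\<close>
  have "p i \<le> (\<nu> / 2 + \<alpha> / 3 * r) * (?x i)\<^sup>2" for i
  proof -
    have "\<bar>?x i\<bar> ^ 3 \<le> r * (?x i)\<^sup>2"
      using mult_right_mono[OF abs_coord_le[OF r, of i], of "(?x i)\<^sup>2"]
      by (simp add: power3_eq_cube power2_eq_square mult_ac)
    hence "\<alpha> / 3 * \<bar>?x i\<bar> ^ 3 \<le> \<alpha> / 3 * (r * (?x i)\<^sup>2)" using assms by simp
    thus ?thesis by (simp add: p_def algebra_simps)
  qed
  note p_le = this
  have p_nonneg: "0 \<le> p i" and q_nonneg: "0 \<le> q i" for i using assms by (simp_all add: p_def q_def)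
  have q: "(q has_sum \<nu> / 2 * (norm x)\<^sup>2) UNIV"
    unfolding q_def norm_ell2_power2 by (intro has_sum_cmult_right has_sum_infsum square_summable_coord)
  have bound: "((\<lambda>i. (\<nu> / 2 + \<alpha> / 3 * r) * (?x i)\<^sup>2) has_sum (\<nu> / 2 + \<alpha> / 3 * r) * (norm x)\<^sup>2) UNIV"
    unfolding norm_ell2_power2 by (intro has_sum_cmult_right has_sum_infsum square_summable_coord)
  have p: "p summable_on UNIV"
    by (rule summable_on_comparison_test[OF has_sum_imp_summable[OF bound] p_le p_nonneg])
  have "infsum p UNIV \<le> (\<nu> / 2 + \<alpha> / 3 * r) * (norm x)\<^sup>2"
    by (rule has_sum_mono[OF has_sum_infsum[OF p] bound p_le])
  hence "infsum p UNIV + infsum q UNIV \<le> (\<nu> + \<alpha> / 3 * r) * (norm x)\<^sup>2"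
    using infsumI[OF q] by (simp add: algebra_simps)
  also have "\<dots> \<le> (\<nu> + \<alpha> / 3 * r) * r\<^sup>2"
    using assms r \<open>0 \<le> r\<close> by (intro mult_left_mono power_mono) auto
  finally have pq: "\<delta> * (infsum p UNIV + infsum q UNIV) \<le> \<delta> * ((\<nu> + \<alpha> / 3 * r) * r\<^sup>2)"
    using \<open>0 \<le> \<delta>\<close> by (rule mult_left_mono)
  let ?P = "\<Sum>\<^sub>\<infinity>i. \<xi> i * p i" and ?Q = "\<Sum>\<^sub>\<infinity>i. \<xi> i * q i"
  have "\<xi> i \<le> \<xi> (i + (-1)) + \<delta>" "\<xi> i \<le> \<xi> (i + 1) + \<delta>" for i
    using \<xi>(3)[of i] \<xi>(3)[of "i - 1"] by auto
  then obtain P' Q' where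
    P': "((\<lambda>i. \<xi> i * p (i + (-1))) has_sum P') UNIV" "P' \<le> ?P + \<delta> * infsum p UNIV" and
    Q': "((\<lambda>i. \<xi> i * q (i + 1)) has_sum Q') UNIV" "Q' \<le> ?Q + \<delta> * infsum q UNIV"
    using weighted_shift_has_sum[OF p p_nonneg \<xi>(1,2)]
      weighted_shift_has_sum[OF has_sum_imp_summable[OF q] q_nonneg \<xi>(1,2)] by meson
  have "((\<lambda>i. \<xi> i * p i) has_sum ?P) UNIV" "((\<lambda>i. \<xi> i * q i) has_sum ?Q) UNIV"
    by (intro has_sum_infsum summable_on_weighted p p_nonneg q_nonneg \<xi>(1,2) has_sum_imp_summable[OF q])+
  note sums = this weighted_has_sum[of \<xi>, OF \<xi>(1,2)]
  have "(1 + \<epsilon> * c) * weighted_sum \<xi> x + 2 * \<epsilon> * (?P + ?Q)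
      \<le> weighted_sum \<xi> y + \<epsilon> / c * weighted_sum \<xi> f + 2 * \<epsilon> * (P' + Q')"
  proof (rule has_sum_mono)
    show "((\<lambda>i. (1 + \<epsilon> * c) * (\<xi> i * (?x i)\<^sup>2) + 2 * \<epsilon> * (\<xi> i * p i + \<xi> i * q i)) has_sum
        (1 + \<epsilon> * c) * weighted_sum \<xi> x + 2 * \<epsilon> * (?P + ?Q)) UNIV"
      by (intro has_sum_add has_sum_cmult_right sums)
    show "((\<lambda>i. \<xi> i * (?y i)\<^sup>2 + \<epsilon> / c * (\<xi> i * (?f i)\<^sup>2)
          + 2 * \<epsilon> * (\<xi> i * p (i + (-1)) + \<xi> i * q (i + 1))) has_sum
        weighted_sum \<xi> y + \<epsilon> / c * weighted_sum \<xi> f + 2 * \<epsilon> * (P' + Q')) UNIV"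
      by (intro has_sum_add has_sum_cmult_right sums P' Q')
    show "(1 + \<epsilon> * c) * (\<xi> i * (?x i)\<^sup>2) + 2 * \<epsilon> * (\<xi> i * p i + \<xi> i * q i)
        \<le> \<xi> i * (?y i)\<^sup>2 + \<epsilon> / c * (\<xi> i * (?f i)\<^sup>2) + 2 * \<epsilon> * (\<xi> i * p (i + (-1)) + \<xi> i * q (i + 1))" for i
      using mult_left_mono[OF pointwise[of i] \<xi>(1)[of i]] by (simp add: algebra_simps)
  qed
  moreover have "2 * \<epsilon> * (P' + Q') \<le> 2 * \<epsilon> * (?P + ?Q + \<delta> * ((\<nu> + \<alpha> / 3 * r) * r\<^sup>2))"
    using P'(2) Q'(2) pq assms by (intro mult_left_mono) (auto simp: algebra_simps)
  ultimately show ?thesis by (simp add: algebra_simps)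
qed

section \<open>Cutoff weights and total boundedness from small tails\<close>

text \<open>The weight is a ramp: zero up to distance \<open>N\<close> from the origin, then rising
  with slope \<open>\<delta>\<close> until it reaches 1 after about \<open>1 / \<delta>\<close>
  further sites.\<close>

lemma slowly_varying_cutoff:
  fixes F :: "int set"
  assumes "finite F" "\<delta> > 0"
  obtains \<xi> :: "int \<Rightarrow> real" and F' where
    "\<And>i. 0 \<le> \<xi> i" "\<And>i. \<xi> i \<le> 1" "\<And>i. \<bar>\<xi> (i + 1) - \<xi> i\<bar> \<le> \<delta>" "\<And>i. i \<in> F \<Longrightarrow> \<xi> i = 0"
    "finite F'" "\<And>i. i \<notin> F' \<Longrightarrow> \<xi> i = 1"
proof -
  obtain N where N: "\<And>i. i \<in> F \<Longrightarrow> \<bar>i\<bar> \<le> N"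
    using bdd_above_finite[of "abs ` F"] assms(1) unfolding bdd_above_def by auto
  define \<xi> :: "int \<Rightarrow> real" where "\<xi> i = max 0 (min 1 (\<delta> * of_int (\<bar>i\<bar> - N)))" for i
  show thesis
  proof (rule that[of \<xi> "{- (\<lceil>1 / \<delta>\<rceil> + N) .. \<lceil>1 / \<delta>\<rceil> + N}"])
    show "\<bar>\<xi> (i + 1) - \<xi> i\<bar> \<le> \<delta>" for i
    proof -
      \<comment> \<open>Truncation to the unit interval does not increase differences, so it
        suffices to bound the slope of the untruncated ramp.\<close>
      have "\<bar>\<delta> * of_int (\<bar>i + 1\<bar> - N) - \<delta> * of_int (\<bar>i\<bar> - N)\<bar> = \<delta> * \<bar>of_int (\<bar>i + 1\<bar> - \<bar>i\<bar>)\<bar>"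
        using assms(2) by (simp add: abs_mult flip: right_diff_distrib)
      also have "\<dots> \<le> \<delta> * 1" using assms(2) by (intro mult_left_mono) linarith+
      finally show ?thesis unfolding \<xi>_def by linarith
    qed
    show "\<xi> i = 0" if "i \<in> F" for i
      using N[OF that] assms(2) by (simp add: \<xi>_def mult_le_0_iff min_le_iff_disj)
    show "\<xi> i = 1" if "i \<notin> {- (\<lceil>1 / \<delta>\<rceil> + N) .. \<lceil>1 / \<delta>\<rceil> + N}" for i
    proof -
      have "\<lceil>1 / \<delta>\<rceil> \<le> \<bar>i\<bar> - N" using that by auto
      hence "1 / \<delta> \<le> of_int (\<bar>i\<bar> - N)" using le_of_int_ceiling of_int_le_iff order_trans by meson
      hence "1 \<le> \<delta> * of_int (\<bar>i\<bar> - N)" using assms(2) by (simp add: field_simps)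
      thus ?thesis by (simp add: \<xi>_def)
    qed
  qed (auto simp: \<xi>_def)
qed

text \<open>\<open>F\<close> is fixed before the weight, since the cutoff is constructed from it
  later. Weighted sum and partial sum over \<open>F\<close> charge each index at most once, so
  together they stay below the full sum.\<close>

lemma square_sum_finite_tail:
  assumes "\<eta> > 0"
  obtains F where "finite F" "\<And>\<xi>. (\<And>i. 0 \<le> \<xi> i) \<Longrightarrow> (\<And>i. \<xi> i \<le> 1) \<Longrightarrow> (\<And>i. i \<in> F \<Longrightarrow> \<xi> i = 0)
    \<Longrightarrow> weighted_sum \<xi> f \<le> \<eta>"
proof -
  obtain F where F: "finite F" "dist (\<Sum>i\<in>F. (coord f i)\<^sup>2) (\<Sum>\<^sub>\<infinity>i. (coord f i)\<^sup>2) \<le> \<eta>"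
    using infsum_finite_approximation[OF square_summable_coord assms] by blast
  show thesis
  proof (rule that[OF F(1)])
    fix \<xi> :: "int \<Rightarrow> real"
    assume \<xi>: "\<And>i. 0 \<le> \<xi> i" "\<And>i. \<xi> i \<le> 1" "\<And>i. i \<in> F \<Longrightarrow> \<xi> i = 0"
    have "((\<lambda>i. if i \<in> F then (coord f i)\<^sup>2 else 0) has_sum (\<Sum>i\<in>F. (coord f i)\<^sup>2)) UNIV"
      by (rule has_sum_finite_neutralI[of F]) (use F in auto)
    from has_sum_add[OF weighted_has_sum[of \<xi> f, OF \<xi>(1,2)] this] has_sum_infsum[OF square_summable_coord]
    have "weighted_sum \<xi> f + (\<Sum>i\<in>F. (coord f i)\<^sup>2) \<le> (\<Sum>\<^sub>\<infinity>i. (coord f i)\<^sup>2)"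
      by (rule has_sum_mono) (use \<xi> in \<open>auto simp: mult_left_le_one_le\<close>)
    with F(2) show "weighted_sum \<xi> f \<le> \<eta>" by (simp add: dist_real_def)
  qed
qed

text \<open>Half of the squared radius pays for rounding on \<open>F\<close>, half for the discarded
  coordinates; these have weight 1, so the weighted sum counts them in full.\<close>

lemma finite_cover_small_tails:
  assumes "e > 0" "finite F" "\<And>i. i \<notin> F \<Longrightarrow> \<xi> i = 1" "\<And>i. 0 \<le> \<xi> i" "\<And>i. \<xi> i \<le> 1"
  shows "\<exists>K. finite K \<and> {u. norm u \<le> r \<and> weighted_sum \<xi> u < e\<^sup>2 / 2} \<subseteq> (\<Union>c\<in>K. ball c e)"
proof -
  \<comment> \<open>Round the coordinates in \<open>F\<close> down to a grid of mesh \<open>h\<close> and drop the others.\<close>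
  define h where "h = e / sqrt (2 * (real (card F) + 1))"
  \<comment> \<open>The added 1 under the root keeps the mesh positive even when \<open>F\<close> is
    empty.\<close>
  have h: "h > 0" "real (card F) * h\<^sup>2 \<le> e\<^sup>2 / 2"
    using assms(1) by (simp_all add: h_def power_divide divide_simps)
  define G where "G = (\<lambda>k. h * of_int k) ` {- \<lceil>r / h\<rceil> - 1 .. \<lceil>r / h\<rceil> + 1}"
  define V where "V = {v :: int \<Rightarrow> real. \<forall>i. (i \<in> F \<longrightarrow> v i \<in> G) \<and> (i \<notin> F \<longrightarrow> v i = 0)}"
  have "finite G" by (simp add: G_def)
  hence "finite V" unfolding V_def using assms(2) by (intro finite_set_of_finite_funs)
  have "u \<in> (\<Union>c\<in>Abs_ell2 ` V. ball c e)" if u: "norm u \<le> r" "weighted_sum \<xi> u < e\<^sup>2 / 2" for u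
  proof -
    define v where "v i = (if i \<in> F then h * of_int \<lfloor>coord u i / h\<rfloor> else 0)" for i
    have "v \<in> V"
    proof -
      have "\<lfloor>coord u i / h\<rfloor> \<in> {- \<lceil>r / h\<rceil> - 1 .. \<lceil>r / h\<rceil> + 1}" for i
      proof -
        have "\<bar>coord u i / h\<bar> \<le> r / h" using abs_coord_le[OF u(1), of i] h(1) by (simp add: divide_right_mono)
        thus ?thesis by (auto; linarith)
      qed
      thus ?thesis by (auto simp: V_def v_def G_def intro!: imageI)
    qed
    have v_sq: "(\<lambda>i. (v i)\<^sup>2) summable_on UNIV"
      by (rule finite_nonzero_values_imp_summable_on, rule finite_subset[OF _ assms(2)])
         (auto simp: v_def)
    hence coord_v: "coord (Abs_ell2 v) = v" by (simp add: Abs_ell2_inverse)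
    have "((\<lambda>i. if i \<in> F then h\<^sup>2 else 0) has_sum (\<Sum>i\<in>F. h\<^sup>2)) UNIV"
      by (rule has_sum_finite_neutralI[of F]) (use assms in auto)
    from has_sum_infsum[OF square_summable_coord] has_sum_add[OF this weighted_has_sum[of \<xi> u, OF assms(4,5)]]
    have "(\<Sum>\<^sub>\<infinity>i. (coord (Abs_ell2 v - u) i)\<^sup>2) \<le> (\<Sum>i\<in>F. h\<^sup>2) + weighted_sum \<xi> u"
    proof (rule has_sum_mono)
      fix i
      show "(coord (Abs_ell2 v - u) i)\<^sup>2 \<le> (if i \<in> F then h\<^sup>2 else 0) + \<xi> i * (coord u i)\<^sup>2"
      proof (cases "i \<in> F")
        case True
        let ?t = "coord u i / h"
        have "\<bar>h * (of_int \<lfloor>?t\<rfloor> - ?t)\<bar> \<le> h * 1"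
        proof -
          have "\<bar>of_int \<lfloor>?t\<rfloor> - ?t\<bar> \<le> 1" by linarith
          thus ?thesis unfolding abs_mult using h(1) by (intro mult_mono) auto
        qed
        hence "(h * (of_int \<lfloor>?t\<rfloor> - ?t))\<^sup>2 \<le> h\<^sup>2" using power_mono[of _ h 2] by fastforce
        moreover have "coord (Abs_ell2 v - u) i = h * (of_int \<lfloor>?t\<rfloor> - ?t)"
          using True h(1) by (simp add: minus_ell2.rep_eq coord_v v_def right_diff_distrib)
        ultimately show ?thesis using True assms(4)[of i] by (simp add: add_increasing2)
      next
        case False
        thus ?thesis using assms(3) by (simp add: minus_ell2.rep_eq coord_v v_def)
      qed
    qed
    also have "\<dots> < e\<^sup>2" using h(2) u(2) by simp
    finally have "(norm (Abs_ell2 v - u))\<^sup>2 < e\<^sup>2" by (simp only: norm_ell2_power2)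
    hence "norm (Abs_ell2 v - u) < e" by (rule power_less_imp_less_base) (use assms in simp)
    thus ?thesis using \<open>v \<in> V\<close> by (auto simp: dist_norm)
  qed
  thus ?thesis using \<open>finite V\<close> by (intro exI[of _ "Abs_ell2 ` V"]) auto
qed

section \<open>The implicit Euler map\<close>

locale implicit_euler_lattice =
  fixes \<alpha> \<beta> \<gamma> \<nu> lam \<epsilon> :: real and f :: ell2
  assumes pos: "\<alpha> > 0" "\<beta> > 0" "\<nu> > 0" "lam > 0" "\<gamma> > 0"
    and lam_gt: "lam > lambda_star \<alpha> \<beta> \<gamma> \<nu>"
    and eps: "\<epsilon> > 0" "\<epsilon> \<le> eps_star \<alpha> \<beta> \<gamma> \<nu> lam f"
begin

abbreviation "V \<equiv> vfield \<alpha> \<beta> \<gamma> \<nu> lam f"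
abbreviation "L \<equiv> L_const \<alpha> \<beta> \<gamma> \<nu> lam"
abbreviation "M \<equiv> M_const \<alpha> \<beta> \<gamma> \<nu> lam f"
abbreviation "R \<equiv> r_star \<alpha> \<beta> \<gamma> \<nu> lam f"
abbreviation "B \<equiv> cball (0 :: ell2) R"

definition c :: real
  where "c = lam - lambda_star \<alpha> \<beta> \<gamma> \<nu>"

lemma c_pos: "c > 0"
  using lam_gt by (simp add: c_def)

lemma R_ge_1: "1 \<le> R"
  using c_pos by (simp add: r_star_def flip: c_def)

lemma norm_f_le: "norm f \<le> c * R"
  using c_pos by (simp add: r_star_def distrib_left flip: c_def)

lemma L_nonneg: "0 \<le> r \<Longrightarrow> 0 \<le> L r"
  using pos unfolding L_const_def by (intro add_nonneg_nonneg mult_nonneg_nonneg real_sqrt_ge_zero) auto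

lemma M_pos:
  assumes "0 < r"
  shows "0 < M r"
proof -
  have "0 < (4 * \<nu> + \<beta> * \<gamma> + lam) * r"
    using pos assms by (intro mult_pos_pos add_pos_pos) auto
  moreover have "0 \<le> \<beta> * r ^ 3" "0 \<le> (2 * \<alpha> + \<beta> + \<beta> * \<gamma>) * r\<^sup>2" using pos assms by auto
  ultimately show ?thesis unfolding M_const_def using norm_ge_zero[of f] by linarith
qed

lemma eps_M: "\<epsilon> * M (R + 1) \<le> 1"
proof -
  have "\<epsilon> \<le> 1 / M (R + 1)" using eps by (simp add: eps_star_def)
  thus ?thesis using M_pos[of "R + 1"] R_ge_1 by (simp add: pos_le_divide_eq)
qed

text \<open>The summand 1 in the second denominator of \<open>eps_star\<close> makes the contraction
  factor strictly less than 1.\<close>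

lemma eps_L: "\<epsilon> * L (R + 1) < 1"
proof -
  have "\<epsilon> \<le> 1 / (1 + L (R + 1))" using eps by (simp add: eps_star_def)
  hence "\<epsilon> * (1 + L (R + 1)) \<le> 1" using L_nonneg[of "R + 1"] R_ge_1 by (simp add: pos_le_divide_eq)
  thus ?thesis using eps by (simp add: distrib_left)
qed

section \<open>Solvability, confinement and continuity of one implicit step\<close>

text \<open>Banach's theorem is applied in a ball one unit larger than \<open>B\<close>: the
  increment has norm at most \<open>\<epsilon> * M (R + 1)\<close>, hence at most 1, so that ball is
  mapped into itself.\<close>

lemma euler_step_ex1:
  assumes "y \<in> B"
  shows "\<exists>!x. x \<in> cball 0 (R + 1) \<and> x = y + \<epsilon> *\<^sub>R V x"
proof -
  have "\<exists>!x\<in>cball 0 (R + 1). y + \<epsilon> *\<^sub>R V x = x"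
  proof (rule Banach_fix)
    show "cball (0::ell2) (R + 1) \<noteq> {}" using R_ge_1 by simp
    show "0 \<le> \<epsilon> * L (R + 1)" using eps L_nonneg[of "R + 1"] R_ge_1 by simp
    show "(\<lambda>x. y + \<epsilon> *\<^sub>R V x) ` cball 0 (R + 1) \<subseteq> cball 0 (R + 1)"
    proof clarsimp
      fix x :: ell2 assume "norm x \<le> R + 1"
      hence "\<epsilon> * norm (V x) \<le> \<epsilon> * M (R + 1)"
        using eps by (intro mult_left_mono norm_vfield_le pos) auto
      moreover have "norm (y + \<epsilon> *\<^sub>R V x) \<le> norm y + \<epsilon> * norm (V x)"
        using norm_triangle_ineq[of y "\<epsilon> *\<^sub>R V x"] eps by simp
      moreover have "norm y \<le> R" using assms by simp
      ultimately show "norm (y + \<epsilon> *\<^sub>R V x) \<le> R + 1" using eps_M by linarith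
    qed
    show "dist (y + \<epsilon> *\<^sub>R V x) (y + \<epsilon> *\<^sub>R V z) \<le> \<epsilon> * L (R + 1) * dist x z"
      if "x \<in> cball 0 (R + 1)" "z \<in> cball 0 (R + 1)" for x z
    proof -
      have "norm (V x - V z) \<le> L (R + 1) * norm (x - z)" using that pos by (intro vfield_lipschitz) auto
      hence "\<epsilon> * norm (V x - V z) \<le> \<epsilon> * (L (R + 1) * norm (x - z))" using eps by simp
      thus ?thesis using eps by (simp add: dist_norm flip: scaleR_diff_right)
    qed
  qed (auto simp: eps_L complete_eq_closed)
  thus ?thesis by (auto simp: eq_commute)
qed

text \<open>The constant weight has \<open>\<delta> = 0\<close>, so all exchange terms cancel. The
  radius in the energy estimate is \<open>norm x\<close> itself, so no prior bound on
  \<open>x\<close> is involved.\<close>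

lemma euler_step_in_B:
  assumes "y \<in> B" "x = y + \<epsilon> *\<^sub>R V x"
  shows "x \<in> B"
proof -
  have "(1 + \<epsilon> * c) * (norm x)\<^sup>2 \<le> (norm y)\<^sup>2 + \<epsilon> / c * (norm f)\<^sup>2"
    using implicit_step_weighted[OF pos(1-3,5) eps(1) c_def c_pos assms(2), of "\<lambda>_. 1" 0 "norm x"]
    by (simp add: weighted_sum_one)
  \<comment> \<open>Bounding the forcing by \<open>c * R\<close> makes the right side
    \<open>(1 + \<epsilon> * c) * R\<^sup>2\<close>, so the factor cancels.\<close>
  also have "\<dots> \<le> R\<^sup>2 + \<epsilon> / c * (c * R)\<^sup>2"
    using assms(1) norm_f_le eps c_pos by (intro add_mono mult_left_mono power_mono) auto
  also have "\<dots> = (1 + \<epsilon> * c) * R\<^sup>2"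
    using c_pos by (simp add: field_simps power2_eq_square)
  finally have "(norm x)\<^sup>2 \<le> R\<^sup>2"
    using mult_pos_pos[OF eps(1) c_pos] by (simp only: mult_le_cancel_left_pos add_pos_pos zero_less_one)
  moreover have "0 \<le> R" using R_ge_1 by linarith
  ultimately have "norm x \<le> R" by (rule power2_le_imp_le)
  thus ?thesis by simp
qed

definition euler_step :: "ell2 \<Rightarrow> ell2"
  where "euler_step y = (THE x. x \<in> cball 0 (R + 1) \<and> x = y + \<epsilon> *\<^sub>R V x)"

lemma euler_step_eq:
  assumes "y \<in> B"
  shows "euler_step y = y + \<epsilon> *\<^sub>R V (euler_step y)"
  using theI'[OF euler_step_ex1[OF assms]] unfolding euler_step_def by blast

lemma euler_step_B: "y \<in> B \<Longrightarrow> euler_step y \<in> B"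
  using euler_step_in_B euler_step_eq by blast

lemma euler_step_unique:
  assumes "y \<in> B" "x \<in> B" "x = y + \<epsilon> *\<^sub>R V x"
  shows "euler_step y = x"
  unfolding euler_step_def
  by (rule the1_equality[OF euler_step_ex1[OF assms(1)]]) (use assms(2,3) in auto)

lemma euler_step_iterate_B: "y \<in> B \<Longrightarrow> (euler_step ^^ n) y \<in> B"
  by (induction n) (use euler_step_B in auto)

text \<open>Subtracting two implicit equations and absorbing the field difference on the left gives
  the Lipschitz constant \<open>1 / (1 - \<epsilon> * L (R + 1))\<close>.\<close>

lemma continuous_euler_step: "continuous_on B euler_step"
proof (rule lipschitz_on_continuous_on[OF lipschitz_onI])
  show "0 \<le> 1 / (1 - \<epsilon> * L (R + 1))" using eps_L by simp
  fix x y assume xy: "x \<in> B" "y \<in> B"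
  let ?x = "euler_step x" and ?y = "euler_step y"
  have "?x - ?y = (x - y) + \<epsilon> *\<^sub>R (V ?x - V ?y)"
    using euler_step_eq[OF xy(1)] euler_step_eq[OF xy(2)] by (simp add: algebra_simps)
  hence "norm (?x - ?y) \<le> norm (x - y) + \<epsilon> * norm (V ?x - V ?y)"
    using norm_triangle_ineq[of "x - y" "\<epsilon> *\<^sub>R (V ?x - V ?y)"] eps by simp
  moreover have "\<epsilon> * norm (V ?x - V ?y) \<le> \<epsilon> * (L (R + 1) * norm (?x - ?y))"
    using euler_step_B[OF xy(1)] euler_step_B[OF xy(2)] pos eps
    by (intro mult_left_mono vfield_lipschitz) auto
  ultimately have "norm (?x - ?y) * (1 - \<epsilon> * L (R + 1)) \<le> norm (x - y)" by (simp add: algebra_simps)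
  thus "dist ?x ?y \<le> 1 / (1 - \<epsilon> * L (R + 1)) * dist x y"
    using eps_L by (simp add: dist_norm pos_le_divide_eq)
qed

section \<open>Uniformly small tails of the iterates\<close>

text \<open>One step is an affine recursion with factor \<open>1 / (1 + \<epsilon> * c)\<close>
  whose fixed point is the bracketed constant; the excess over it decays geometrically from at most
  \<open>R\<^sup>2\<close>.\<close>

lemma weighted_sum_iterate_le:
  assumes \<xi>: "\<And>i. 0 \<le> \<xi> i" "\<And>i. \<xi> i \<le> 1" "\<And>i. \<bar>\<xi> (i + 1) - \<xi> i\<bar> \<le> \<delta>" and y: "y \<in> B"
  shows "weighted_sum \<xi> ((euler_step ^^ n) y) \<le> R\<^sup>2 / (1 + \<epsilon> * c) ^ n
    + (weighted_sum \<xi> f / c\<^sup>2 + 2 * \<delta> * ((\<nu> + \<alpha> / 3 * R) * R\<^sup>2) / c)" (is "?b n \<le> _ + ?\<kappa>")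
proof (induction n)
  case 0
  have "weighted_sum \<xi> y \<le> (norm y)\<^sup>2" by (rule weighted_sum_le_norm[OF \<xi>(1,2)])
  also have "\<dots> \<le> R\<^sup>2" using y by (simp add: power_mono)
  finally have "weighted_sum \<xi> y \<le> R\<^sup>2" .
  moreover have "0 \<le> weighted_sum \<xi> f" unfolding weighted_sum_def by (rule infsum_nonneg) (simp add: \<xi>)
  moreover have "0 \<le> \<delta>" using \<xi>(3)[of 0] by linarith
  ultimately have "0 \<le> ?\<kappa>" using pos c_pos R_ge_1
    by (intro add_nonneg_nonneg divide_nonneg_nonneg mult_nonneg_nonneg) auto
  with \<open>weighted_sum \<xi> y \<le> R\<^sup>2\<close> show ?case by simp
next
  case (Suc n)
  let ?x = "(euler_step ^^ n) y"
  have q: "1 + \<epsilon> * c > 0" using eps c_pos by (simp add: add_pos_pos)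
  have x: "?x \<in> B" using euler_step_iterate_B[OF y] .
  have "(1 + \<epsilon> * c) * ?b (Suc n) \<le> ?b n + \<epsilon> / c * weighted_sum \<xi> f
      + 2 * \<epsilon> * \<delta> * ((\<nu> + \<alpha> / 3 * R) * R\<^sup>2)"
    using implicit_step_weighted[where \<xi> = \<xi> and r = R,
        OF pos(1-3,5) eps(1) c_def c_pos euler_step_eq[OF x] \<xi>]
      euler_step_B[OF x] by simp
  also have "\<dots> = ?b n + \<epsilon> * c * ?\<kappa>" using c_pos by (simp add: field_simps power2_eq_square)
  also have "\<dots> \<le> R\<^sup>2 / (1 + \<epsilon> * c) ^ n + (1 + \<epsilon> * c) * ?\<kappa>" using Suc.IH by (simp add: distrib_right)
  also have "\<dots> = (1 + \<epsilon> * c) * (R\<^sup>2 / (1 + \<epsilon> * c) ^ Suc n + ?\<kappa>)"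
    using q by (simp add: distrib_left)
  finally show ?case using q by (simp only: mult_le_cancel_left_pos)
qed

text \<open>Order of choices: \<open>\<delta>\<close> from \<open>e\<close>, \<open>F\<close> from
  the tail of \<open>f\<close>, the cutoff from both, and \<open>N\<close> last, uniformly in the
  starting point. The three contributions are at most \<open>e\<^sup>2 / 16\<close>,
  \<open>e\<^sup>2 / 16\<close> and \<open>e\<^sup>2 / 4\<close>, below \<open>e\<^sup>2 / 2\<close>
  in total.\<close>

lemma euler_step_finite_cover:
  assumes "e > 0"
  shows "\<exists>N K. finite K \<and> (euler_step ^^ N) ` B \<subseteq> (\<Union>x\<in>K. ball x e)"
proof -
  define C where "C = (\<nu> + \<alpha> / 3 * R) * R\<^sup>2"
  have "C > 0" unfolding C_def using pos R_ge_1 by (intro mult_pos_pos add_pos_pos) auto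
  \<comment> \<open>Solves \<open>2 * \<delta> * C / c = e\<^sup>2 / 16\<close>, the share allotted
    to the variation of the weight.\<close>
  define \<delta> where "\<delta> = c * e\<^sup>2 / (32 * C)"
  have "\<delta> > 0" using assms c_pos \<open>C > 0\<close> by (simp add: \<delta>_def)
  have "c\<^sup>2 * e\<^sup>2 / 16 > 0" using assms c_pos by simp
  then obtain F where F: "finite F" "\<And>\<xi>. (\<And>i. 0 \<le> \<xi> i) \<Longrightarrow> (\<And>i. \<xi> i \<le> 1) \<Longrightarrow> (\<And>i. i \<in> F \<Longrightarrow> \<xi> i = 0)
      \<Longrightarrow> weighted_sum \<xi> f \<le> c\<^sup>2 * e\<^sup>2 / 16"
    by (rule square_sum_finite_tail[where f = f]) blast
  obtain \<xi> :: "int \<Rightarrow> real" and F' where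
    \<xi>: "\<And>i. 0 \<le> \<xi> i" "\<And>i. \<xi> i \<le> 1" "\<And>i. \<bar>\<xi> (i + 1) - \<xi> i\<bar> \<le> \<delta>" "\<And>i. i \<in> F \<Longrightarrow> \<xi> i = 0"
      "finite F'" "\<And>i. i \<notin> F' \<Longrightarrow> \<xi> i = 1"
    using slowly_varying_cutoff[OF F(1) \<open>\<delta> > 0\<close>] by blast
  have half_bound: "w < e\<^sup>2 / 2"
    if "a \<le> e\<^sup>2 / 16" "b = e\<^sup>2 / 16" "p < e\<^sup>2 / 4" "w \<le> p + (a + b)" for w a b p
    using that zero_le_power2[of e] by linarith
  have "weighted_sum \<xi> f / c\<^sup>2 \<le> e\<^sup>2 / 16"
    using F(2)[of \<xi>] \<xi> c_pos by (simp add: divide_simps mult_ac)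
  moreover have "2 * \<delta> * C / c = e\<^sup>2 / 16" using c_pos \<open>C > 0\<close> by (simp add: \<delta>_def field_simps)
  moreover obtain N where "4 * R\<^sup>2 / e\<^sup>2 < (1 + \<epsilon> * c) ^ N"
    using real_arch_pow[of "1 + \<epsilon> * c"] eps c_pos by auto
  hence "R\<^sup>2 / (1 + \<epsilon> * c) ^ N < e\<^sup>2 / 4"
    using assms eps c_pos by (simp add: field_simps add_pos_pos)
  ultimately have "weighted_sum \<xi> ((euler_step ^^ N) y) < e\<^sup>2 / 2" if "y \<in> B" for y
    using weighted_sum_iterate_le[of \<xi>, OF \<xi>(1-3) that, of N] unfolding C_def[symmetric]
    by (rule half_bound)
  moreover have "norm ((euler_step ^^ N) y) \<le> R" if "y \<in> B" for y
    using euler_step_iterate_B[OF that, of N] by simp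
  ultimately have "(euler_step ^^ N) ` B \<subseteq> {u. norm u \<le> R \<and> weighted_sum \<xi> u < e\<^sup>2 / 2}" by blast
  thus ?thesis using finite_cover_small_tails[of e F' \<xi>, OF assms \<xi>(5,6,1,2), of R] by blast
qed

sublocale asymptotically_compact_map euler_step B
  using euler_step_B continuous_euler_step euler_step_finite_cover
  by unfold_locales (auto simp del: mem_cball)

section \<open>Transfer from iterates of the step to the scheme\<close>

text \<open>A solution is confined to \<open>B\<close> by definition, so uniqueness of the step
  applies at every index and the description in \<open>euler_map\<close> denotes the orbit.\<close>

lemma euler_solution_iff:
  assumes "y \<in> B"
  shows "euler_solution \<alpha> \<beta> \<gamma> \<nu> lam f \<epsilon> y u \<longleftrightarrow> u = (\<lambda>n. (euler_step ^^ n) y)"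
proof
  assume u: "euler_solution \<alpha> \<beta> \<gamma> \<nu> lam f \<epsilon> y u"
  have "u n = (euler_step ^^ n) y" for n
  proof (induction n)
    case (Suc n)
    have B: "u m \<in> B" and step: "m \<ge> 1 \<Longrightarrow> u m = u (m - 1) + \<epsilon> *\<^sub>R V (u m)" for m
      using u unfolding euler_solution_def by blast+
    have "u (Suc n) = u n + \<epsilon> *\<^sub>R V (u (Suc n))" using step[of "Suc n"] by simp
    with B[of n] B[of "Suc n"] have "euler_step (u n) = u (Suc n)" by (intro euler_step_unique)
    thus ?case by (simp add: Suc)
  qed (use u in \<open>simp add: euler_solution_def\<close>)
  thus "u = (\<lambda>n. (euler_step ^^ n) y)" by blast
next
  assume u: "u = (\<lambda>n. (euler_step ^^ n) y)"
  have "u n = u (n - 1) + \<epsilon> *\<^sub>R V (u n)" if "n \<ge> 1" for n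
    using euler_step_eq[OF euler_step_iterate_B[OF assms, of "n - 1"]] that
    by (cases n) (auto simp: u)
  thus "euler_solution \<alpha> \<beta> \<gamma> \<nu> lam f \<epsilon> y u"
    using euler_step_iterate_B[OF assms] by (simp add: euler_solution_def u)
qed

lemma euler_map_eq:
  assumes "y \<in> B"
  shows "euler_map \<alpha> \<beta> \<gamma> \<nu> lam f \<epsilon> n y = (euler_step ^^ n) y"
  by (simp add: euler_map_def euler_solution_iff[OF assms])

lemma euler_map_image:
  assumes "A \<subseteq> B"
  shows "euler_map \<alpha> \<beta> \<gamma> \<nu> lam f \<epsilon> n ` A = (euler_step ^^ n) ` A"
  using euler_map_eq assms by (intro image_cong) blast+

lemma numerical_attractor_iff: "numerical_attractor \<alpha> \<beta> \<gamma> \<nu> lam f \<epsilon> A \<longleftrightarrow> A = attractor"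
proof
  assume A: "numerical_attractor \<alpha> \<beta> \<gamma> \<nu> lam f \<epsilon> A"
  hence "A \<subseteq> B" by (simp add: numerical_attractor_def)
  \<comment> \<open>Invariance at time 1 is invariance under the step map, the form that
    \<open>attractor_unique\<close> expects.\<close>
  have "euler_map \<alpha> \<beta> \<gamma> \<nu> lam f \<epsilon> 1 ` A = A" using A unfolding numerical_attractor_def by blast
  hence "euler_step ` A = A" by (simp add: euler_map_image[OF \<open>A \<subseteq> B\<close>])
  with A \<open>A \<subseteq> B\<close> show "A = attractor"
    by (intro attractor_unique) (simp_all add: numerical_attractor_def euler_map_image compact_imp_closed)
next
  assume "A = attractor"
  thus "numerical_attractor \<alpha> \<beta> \<gamma> \<nu> lam f \<epsilon> A"
    using compact_attractor attractor_subset attractor_attracts iterate_image_invariant[OF image_attractor]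
    by (simp add: numerical_attractor_def euler_map_image)
qed

end

theorem theorem3p1:
  fixes \<alpha> \<beta> \<gamma> \<nu> lam \<epsilon> :: real and f :: ell2
  assumes "\<alpha> > 0" "\<beta> > 0" "\<nu> > 0" "lam > 0" "0 < \<gamma>" "\<gamma> < 1"
    and "lam > lambda_star \<alpha> \<beta> \<gamma> \<nu>"
    and "\<epsilon> \<in> {0<..eps_star \<alpha> \<beta> \<gamma> \<nu> lam f}"
  shows "(\<exists>!A. numerical_attractor \<alpha> \<beta> \<gamma> \<nu> lam f \<epsilon> A) \<and>
    (\<forall>A. numerical_attractor \<alpha> \<beta> \<gamma> \<nu> lam f \<epsilon> A \<longrightarrow>
      A = (\<Inter>m. closure (\<Union>n\<in>{m..}.
            euler_map \<alpha> \<beta> \<gamma> \<nu> lam f \<epsilon> n ` B_star \<alpha> \<beta> \<gamma> \<nu> lam f)))"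
proof -
  interpret implicit_euler_lattice \<alpha> \<beta> \<gamma> \<nu> lam \<epsilon> f
    by standard (use assms in auto)
  show ?thesis
    by (simp add: numerical_attractor_iff euler_map_image attractor_eq_omega_limit)
qed

end
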